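(* There is an algorithm which, for every instance of metric CUFTRA with uniform requirements, outputs a feasible solution of total cost at most $2.89$ times the minimum total cost of a feasible solution, and runs in time $O(n^{3}\max_j r_j)$, where $n=|\mathcal{F}|+|\mathcal{C}|$.
   Context: An instance of CUFTRA (Capacitated Unconstrained Fault-Tolerant Resource Allocation) consists of a finite set $\mathcal{F}$ of sites, a finite set $\mathcal{C}$ of clients, opening costs $f_i\ge 0$ and positive integer capacities $u_i$ ($i\in\mathcal{F}$), connection costs $c_{ij}\ge0$ ($i\in\mathcal{F}$, $j\in\mathcal{C}$), and positive integer requirements $r_j$ ($j\in\mathcal{C}$). A feasible solution is a choice of nonnegative integers $y_i$, $x_{ij}$ with $\sum_i x_{ij}\ge r_j$ for all $j$, $x_{ij}\le y_i$ for all $i,j$, and $\sum_j x_{ij}\le u_iy_i$ for all $i$; its total cost is $\sum_i f_iy_i+\sum_{i,j}c_{ij}x_{ij}$. The instance is metric if $c_{ij}\le c_{ij'}+c_{i'j'}+c_{i'j}$ for all $i,i'\in\mathcal{F}$, $j,j'\in\mathcal{C}$; requirements are uniform if $r_j=r$ for all $j$ for some positive integer $r$. *)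

theory Defs
  imports Complex_Main
begin

text \<open>Sites are indexed by 0..nF-1 and clients by 0..nC-1.
  f i: opening cost, u i: capacity, c i j: connection cost, r j: requirement.\<close>

definition cuftra_instance ::
  "nat \<Rightarrow> nat \<Rightarrow> (nat \<Rightarrow> real) \<Rightarrow> (nat \<Rightarrow> nat) \<Rightarrow> (nat \<Rightarrow> nat \<Rightarrow> real) \<Rightarrow> (nat \<Rightarrow> nat) \<Rightarrow> bool"
  where
  "cuftra_instance nF nC f u c r \<longleftrightarrow>
     1 \<le> nF \<and>
     (\<forall>i<nF. 0 \<le> f i \<and> 0 < u i) \<and>
     (\<forall>i<nF. \<forall>j<nC. 0 \<le> c i j) \<and>
     (\<forall>j<nC. 0 < r j)"

definition metric_instance :: "nat \<Rightarrow> nat \<Rightarrow> (nat \<Rightarrow> nat \<Rightarrow> real) \<Rightarrow> bool" where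
  "metric_instance nF nC c \<longleftrightarrow>
     (\<forall>i<nF. \<forall>i'<nF. \<forall>j<nC. \<forall>j'<nC. c i j \<le> c i j' + c i' j' + c i' j)"

definition uniform_requirements :: "nat \<Rightarrow> (nat \<Rightarrow> nat) \<Rightarrow> bool" where
  "uniform_requirements nC r \<longleftrightarrow> (\<exists>rr>0. \<forall>j<nC. r j = rr)"

text \<open>A solution: y i (copies of site i), x i j (connections of client j to site i);
  integer valued, required to be nonnegative by feasibility.\<close>

definition feasible ::
  "nat \<Rightarrow> nat \<Rightarrow> (nat \<Rightarrow> nat) \<Rightarrow> (nat \<Rightarrow> nat) \<Rightarrow> (nat \<Rightarrow> int) \<Rightarrow> (nat \<Rightarrow> nat \<Rightarrow> int) \<Rightarrow> bool"
  where
  "feasible nF nC u r y x \<longleftrightarrow>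
     (\<forall>i<nF. 0 \<le> y i) \<and>
     (\<forall>i<nF. \<forall>j<nC. 0 \<le> x i j) \<and>
     (\<forall>j<nC. (\<Sum>i<nF. x i j) \<ge> int (r j)) \<and>
     (\<forall>i<nF. \<forall>j<nC. x i j \<le> y i) \<and>
     (\<forall>i<nF. (\<Sum>j<nC. x i j) \<le> int (u i) * y i)"

definition total_cost ::
  "nat \<Rightarrow> nat \<Rightarrow> (nat \<Rightarrow> real) \<Rightarrow> (nat \<Rightarrow> nat \<Rightarrow> real) \<Rightarrow> (nat \<Rightarrow> int) \<Rightarrow> (nat \<Rightarrow> nat \<Rightarrow> int) \<Rightarrow> real"
  where
  "total_cost nF nC f c y x =
     (\<Sum>i<nF. f i * of_int (y i)) + (\<Sum>i<nF. \<Sum>j<nC. c i j * of_int (x i j))"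

definition max_req :: "nat \<Rightarrow> (nat \<Rightarrow> nat) \<Rightarrow> nat" where
  "max_req nC r = Max (insert 0 (r ` {..<nC}))"

text \<open>Two memories indexed by integers: an integer memory I and a real memory R.
  Integer arithmetic is restricted to addition/subtraction (no unit-cost integer multiplication),
  reals support field operations and comparisons; there is no conversion from reals to integers
  (no floor), and program constants are integers only. Indirect addressing uses integer cells.
  Each executed instruction costs one time unit.\<close>

datatype instr =
    IConst int int
  | IAdd int int int
  | ISub int int int
  | ILoad int int
  | IStore int int
  | IToR int int
  | RLoad int int
  | RStore int int
  | RAdd int int int
  | RSub int int int
  | RMul int int int
  | RDiv int int int
  | JumpILe int int nat
  | JumpRLe int int nat
  | Halt

type_synonym mstate = "nat \<times> (int \<Rightarrow> int) \<times> (int \<Rightarrow> real)"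

fun exec :: "instr \<Rightarrow> mstate \<Rightarrow> mstate" where
  "exec (IConst a k) (pc, I, R) = (Suc pc, I(a := k), R)"
| "exec (IAdd a b c) (pc, I, R) = (Suc pc, I(a := I b + I c), R)"
| "exec (ISub a b c) (pc, I, R) = (Suc pc, I(a := I b - I c), R)"
| "exec (ILoad a b) (pc, I, R) = (Suc pc, I(a := I (I b)), R)"
| "exec (IStore a b) (pc, I, R) = (Suc pc, I(I a := I b), R)"
| "exec (IToR a b) (pc, I, R) = (Suc pc, I, R(a := of_int (I b)))"
| "exec (RLoad a b) (pc, I, R) = (Suc pc, I, R(a := R (I b)))"
| "exec (RStore a b) (pc, I, R) = (Suc pc, I, R(I a := R b))"
| "exec (RAdd a b c) (pc, I, R) = (Suc pc, I, R(a := R b + R c))"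
| "exec (RSub a b c) (pc, I, R) = (Suc pc, I, R(a := R b - R c))"
| "exec (RMul a b c) (pc, I, R) = (Suc pc, I, R(a := R b * R c))"
| "exec (RDiv a b c) (pc, I, R) = (Suc pc, I, R(a := R b / R c))"
| "exec (JumpILe a b l) (pc, I, R) = (if I a \<le> I b then l else Suc pc, I, R)"
| "exec (JumpRLe a b l) (pc, I, R) = (if R a \<le> R b then l else Suc pc, I, R)"
| "exec Halt s = s"

definition halted :: "instr list \<Rightarrow> mstate \<Rightarrow> bool" where
  "halted P s \<longleftrightarrow> fst s \<ge> length P \<or> P ! fst s = Halt"

definition step :: "instr list \<Rightarrow> mstate \<Rightarrow> mstate" where
  "step P s = (if halted P s then s else exec (P ! fst s) s)"

definition run :: "instr list \<Rightarrow> nat \<Rightarrow> mstate \<Rightarrow> mstate" where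
  "run P k s = (step P ^^ k) s"

definition init_state ::
  "nat \<Rightarrow> nat \<Rightarrow> (nat \<Rightarrow> real) \<Rightarrow> (nat \<Rightarrow> nat) \<Rightarrow> (nat \<Rightarrow> nat \<Rightarrow> real) \<Rightarrow> (nat \<Rightarrow> nat) \<Rightarrow> mstate"
  where
  "init_state nF nC f u c r =
    (0,
     (\<lambda>a. if a = 0 then int nF
          else if a = 1 then int nC
          else if 2 \<le> a \<and> a < 2 + int nC then int (r (nat (a - 2)))
          else if 2 + int nC \<le> a \<and> a < 2 + int nC + int nF then int (u (nat (a - 2 - int nC)))
          else 0),
     (\<lambda>a. if 0 \<le> a \<and> a < int nF then f (nat a)
          else if int nF \<le> a \<and> a < int nF + int nF * int nC
            then c (nat ((a - int nF) div int nC)) (nat ((a - int nF) mod int nC))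
          else 0))"

definition out_y :: "mstate \<Rightarrow> nat \<Rightarrow> int" where
  "out_y s i = fst (snd s) (- (1 + int i))"

definition out_x :: "nat \<Rightarrow> nat \<Rightarrow> mstate \<Rightarrow> nat \<Rightarrow> nat \<Rightarrow> int" where
  "out_x nF nC s i j = fst (snd s) (- (1 + int nF + int i * int nC + int j))"

end

theory Submission
  imports Defs
begin

text \<open>Copies are unlimited, so \<open>r\<close> times a solution for unit requirements is a solution for uniform
  requirement \<open>r\<close>; as the algorithm for unit requirements is analysed against fractional solutions,
  the factor survives this scaling.  Charging every connection to site \<open>i\<close> an extra \<open>f i / u i\<close> removes
  the capacities, since \<open>k\<close> clients need at most \<open>1 + k / u i\<close> copies.  The uncapacitated problem is
  solved greedily (Jain, Mahdian, Saberi): repeatedly pick the site and the set \<open>B\<close> of unconnected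
  clients with least average cost, where savings of connected clients that switch to the site are
  deducted, and let each client of \<open>B\<close> pay this average.  If client \<open>j\<close> pays \<open>\<alpha>\<close> and \<open>i\<close> is any site, the
  metric inequality shows that every client \<open>l\<close> connected before costs at least \<open>\<alpha> - c i j - c i l\<close> at
  that time: the detour through \<open>i\<close> carries no surcharge.  So switching \<open>l\<close> to \<open>i\<close> would save much, and as
  \<open>\<alpha>\<close> is a minimum, averaging over any set \<open>S\<close> of clients shows that together they pay at most
  \<open>f i + \<Sum>\<^sub>j\<^sub>\<in>\<^sub>S (f i / u i + 2 * c i j)\<close>; weak duality then gives the factor \<open>2\<close>.

  The clients are sorted once around every site, so that one greedy step takes time \<open>O(nF * nC)\<close>; there
  are at most \<open>nC\<close> steps.\<close>

section \<open>Structured programs with running times\<close>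

text \<open>The factor 2 has two sources. An earlier client \<open>l\<close> enters the price bound
  of \<open>j\<close> with \<open>c i j + 2 * c i l\<close> instead of \<open>c i l\<close>; the
  excess \<open>c i j + c i l\<close> is symmetric, and of two clients at most one is earlier than
  the other, so over a set \<open>S\<close> the excess averages out to one more copy of the
  connection costs. The opening costs double because a solution makes at most
  \<open>u i * y i\<close> connections at site \<open>i\<close>, so the surcharges
  \<open>f i / u i\<close> on them add up to at most a second \<open>f i * y i\<close>. Since costs
  are nonnegative, 2 implies the claimed 2.89.

  The machine dictates the form of the program. It has no integer multiplication or division and no
  conversion from reals to integers, so the number of copies, a rounded-up quotient, cannot be
  computed directly. Clients are handed out one by one, a real register holds the free places of the
  current copy, and the requirement is added to the count whenever a new copy starts. Addresses in
  the cost matrix are likewise advanced by addition only. Step counts are proved for structured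
  programs, where invariants can be attached to loops, and transferred once to the compiled
  jumps.\<close>

type_synonym memory = "(int \<Rightarrow> int) \<times> (int \<Rightarrow> real)"

datatype com =
    Bas "instr list"
  | Seq com com (infixr ";;" 60)
  | IfI int int com com
  | IfR int int com com
  | While int int com

fun plain :: "instr \<Rightarrow> bool" where
  "plain (JumpILe a b l) = False"
| "plain (JumpRLe a b l) = False"
| "plain Halt = False"
| "plain i = True"

definition eff :: "instr \<Rightarrow> memory \<Rightarrow> memory" where
  "eff i s = snd (exec i (0, s))"

fun wf :: "com \<Rightarrow> bool" where
  "wf (Bas is) = list_all plain is"
| "wf (c1 ;; c2) = (wf c1 \<and> wf c2)"
| "wf (IfI a b c1 c2) = (wf c1 \<and> wf c2)"
| "wf (IfR a b c1 c2) = (wf c1 \<and> wf c2)"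
| "wf (While a b c) = wf c"

fun clen :: "com \<Rightarrow> nat" where
  "clen (Bas is) = length is"
| "clen (c1 ;; c2) = clen c1 + clen c2"
| "clen (IfI a b c1 c2) = clen c1 + clen c2 + 2"
| "clen (IfR a b c1 c2) = clen c1 + clen c2 + 2"
| "clen (While a b c) = clen c + 2"

text \<open>Jump targets are absolute, hence the start address \<open>p\<close>.
  \<open>JumpILe 0 0\<close> always jumps. The code of the else branch precedes that of the then
  branch, so it alone ends with a jump; this is the extra step in \<open>IfIF\<close> and
  \<open>IfRF\<close>.\<close>

fun compile :: "nat \<Rightarrow> com \<Rightarrow> instr list" where
  "compile p (Bas is) = is"
| "compile p (c1 ;; c2) = compile p c1 @ compile (p + clen c1) c2"
| "compile p (IfI a b c1 c2) = JumpILe a b (p + clen c2 + 2) # compile (p + 1) c2 @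
     JumpILe 0 0 (p + clen c2 + 2 + clen c1) # compile (p + clen c2 + 2) c1"
| "compile p (IfR a b c1 c2) = JumpRLe a b (p + clen c2 + 2) # compile (p + 1) c2 @
     JumpILe 0 0 (p + clen c2 + 2 + clen c1) # compile (p + clen c2 + 2) c1"
| "compile p (While a b c) = JumpILe b a (p + clen c + 2) # compile (p + 1) c @ [JumpILe 0 0 p]"

inductive big :: "com \<Rightarrow> memory \<Rightarrow> nat \<Rightarrow> memory \<Rightarrow> bool" where
  Bas: "big (Bas is) s (length is) (fold eff is s)"
| Seq: "big c1 s k s1 \<Longrightarrow> big c2 s1 l s2 \<Longrightarrow> big (c1 ;; c2) s (k + l) s2"
| IfIT: "fst s a \<le> fst s b \<Longrightarrow> big c1 s k s1 \<Longrightarrow> big (IfI a b c1 c2) s (Suc k) s1"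
| IfIF: "\<not> fst s a \<le> fst s b \<Longrightarrow> big c2 s k s1 \<Longrightarrow> big (IfI a b c1 c2) s (Suc (Suc k)) s1"
| IfRT: "snd s a \<le> snd s b \<Longrightarrow> big c1 s k s1 \<Longrightarrow> big (IfR a b c1 c2) s (Suc k) s1"
| IfRF: "\<not> snd s a \<le> snd s b \<Longrightarrow> big c2 s k s1 \<Longrightarrow> big (IfR a b c1 c2) s (Suc (Suc k)) s1"
| WhileF: "\<not> fst s a < fst s b \<Longrightarrow> big (While a b c) s 1 s"
| WhileT: "fst s a < fst s b \<Longrightarrow> big c s k s1 \<Longrightarrow> big (While a b c) s1 l s2 \<Longrightarrow>
    big (While a b c) s (k + l + 2) s2"

lemma length_compile [simp]: "length (compile p c) = clen c"
  by (induction c arbitrary: p) auto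

section \<open>Simulation of structured programs by compiled code\<close>

definition code_at :: "instr list \<Rightarrow> nat \<Rightarrow> instr list \<Rightarrow> bool" where
  "code_at P p is \<longleftrightarrow> (\<exists>as bs. P = as @ is @ bs \<and> length as = p)"

lemma code_at_append: "code_at P p (is @ js) \<longleftrightarrow> code_at P p is \<and> code_at P (p + length is) js"
proof
  assume "code_at P p (is @ js)"
  then obtain as bs where *: "P = as @ (is @ js) @ bs" "length as = p"
    by (auto simp: code_at_def)
  have "P = as @ is @ (js @ bs)" "P = (as @ is) @ js @ bs"
    using * by simp_all
  then show "code_at P p is \<and> code_at P (p + length is) js"
    using *(2) unfolding code_at_def
    by (intro conjI exI[of _ as] exI[of _ "as @ is"] exI[of _ "js @ bs"] exI[of _ bs]) simp_all
next
  assume "code_at P p is \<and> code_at P (p + length is) js"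
  then obtain as bs as' bs' where *: "P = as @ is @ bs" "length as = p"
    "P = as' @ js @ bs'" "length as' = p + length is"
    unfolding code_at_def by blast
  have "(as @ is) @ bs = as' @ js @ bs'" using * by simp
  then have "js @ bs' = bs"
    using append_eq_append_conv[of "as @ is" as' bs "js @ bs'"] * by simp
  then show "code_at P p (is @ js)"
    using *(1,2) unfolding code_at_def by (intro exI[of _ as] exI[of _ bs']) simp
qed

lemma code_at_Cons: "code_at P p (i # is) \<longleftrightarrow> code_at P p [i] \<and> code_at P (Suc p) is"
  using code_at_append[of P p "[i]" "is"] by simp

lemma step_code_at:
  assumes "code_at P p [i]" "i \<noteq> Halt"
  shows "step P (p, s) = exec i (p, s)"
  using assms by (auto simp: code_at_def step_def halted_def nth_append)

lemma exec_plain: "plain i \<Longrightarrow> exec i (p, s) = (Suc p, eff i s)"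
  by (cases s; cases i) (auto simp: eff_def)

lemma exec_jump [simp]:
  "exec (JumpILe a b l) (p, s) = (if fst s a \<le> fst s b then l else Suc p, s)"
  "exec (JumpRLe a b l) (p, s) = (if snd s a \<le> snd s b then l else Suc p, s)"
  by (cases s; simp)+

lemma run_Suc_code_at:
  assumes "code_at P p [i]" "i \<noteq> Halt" "exec i (p, s) = (q, s')"
  shows "(step P ^^ Suc k) (p, s) = (step P ^^ k) (q, s')"
  using step_code_at[OF assms(1,2)] assms(3) by (simp add: funpow_Suc_right del: funpow.simps)

lemma run_plain:
  assumes "code_at P p is" "list_all plain is"
  shows "(step P ^^ length is) (p, s) = (p + length is, fold eff is s)"
  using assms
proof (induction "is" arbitrary: p s)
  case (Cons i "is")
  have "i \<noteq> Halt" "plain i" using Cons.prems(2) by auto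
  moreover have "code_at P p [i]" "code_at P (Suc p) is"
    using Cons.prems(1) code_at_Cons[of P p i "is"] by blast+
  ultimately show ?case
    using run_Suc_code_at[OF _ _ exec_plain, where P = P and k = "length is"]
      Cons.IH[of "Suc p" "eff i s"] Cons.prems(2)
    by (simp del: funpow.simps)
qed simp

text \<open>Stated for code lying anywhere inside a program \<open>P\<close>, because the induction
  descends into subcommands whose code is surrounded by that of the rest.\<close>

lemma big_imp_run:
  assumes "big c s k s'" "wf c" "code_at P p (compile p c)"
  shows "(step P ^^ k) (p, s) = (p + clen c, s')"
  using assms
proof (induction arbitrary: p rule: big.induct)
  case (Bas "is" s)
  then show ?case using run_plain by simp
next
  case (Seq c1 s k s1 c2 l s2)
  then have "(step P ^^ k) (p, s) = (p + clen c1, s1)"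
    "(step P ^^ l) (p + clen c1, s1) = (p + clen c1 + clen c2, s2)"
    by (auto simp: code_at_append)
  then show ?case by (simp add: add.commute[of k] funpow_add)
next
  case (IfIT s a b c1 k s1 c2)
  then have "code_at P p [JumpILe a b (p + clen c2 + 2)]"
    "code_at P (p + clen c2 + 2) (compile (p + clen c2 + 2) c1)"
    by (auto simp: code_at_append code_at_Cons[of _ _ _ "_ @ _"] code_at_Cons[of _ _ _ "compile _ _"]
        algebra_simps)
  then show ?case
    using IfIT run_Suc_code_at[of P p _ s "p + clen c2 + 2" s k] by (simp add: algebra_simps)
next
  case (IfIF s a b c2 k s1 c1)
  then have *: "code_at P p [JumpILe a b (p + clen c2 + 2)]"
    "code_at P (Suc p) (compile (Suc p) c2)"
    "code_at P (Suc p + clen c2) [JumpILe 0 0 (p + clen c2 + 2 + clen c1)]"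
    by (auto simp: code_at_append code_at_Cons[of _ _ _ "_ @ _"] code_at_Cons[of _ _ _ "compile _ _"])
  have "(step P ^^ k) (Suc p, s) = (Suc p + clen c2, s1)"
    using IfIF * by simp
  then have "(step P ^^ Suc k) (p, s) = (Suc p + clen c2, s1)"
    using run_Suc_code_at[OF *(1)] IfIF by simp
  moreover have "step P (Suc p + clen c2, s1) = (p + clen c2 + 2 + clen c1, s1)"
    using run_Suc_code_at[OF *(3), of s1 "p + clen c2 + 2 + clen c1" s1 0] by simp
  ultimately show ?case by (simp add: algebra_simps)
next
  case (IfRT s a b c1 k s1 c2)
  then have "code_at P p [JumpRLe a b (p + clen c2 + 2)]"
    "code_at P (p + clen c2 + 2) (compile (p + clen c2 + 2) c1)"
    by (auto simp: code_at_append code_at_Cons[of _ _ _ "_ @ _"] code_at_Cons[of _ _ _ "compile _ _"]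
        algebra_simps)
  then show ?case
    using IfRT run_Suc_code_at[of P p _ s "p + clen c2 + 2" s k] by (simp add: algebra_simps)
next
  case (IfRF s a b c2 k s1 c1)
  then have *: "code_at P p [JumpRLe a b (p + clen c2 + 2)]"
    "code_at P (Suc p) (compile (Suc p) c2)"
    "code_at P (Suc p + clen c2) [JumpILe 0 0 (p + clen c2 + 2 + clen c1)]"
    by (auto simp: code_at_append code_at_Cons[of _ _ _ "_ @ _"] code_at_Cons[of _ _ _ "compile _ _"])
  have "(step P ^^ k) (Suc p, s) = (Suc p + clen c2, s1)"
    using IfRF * by simp
  then have "(step P ^^ Suc k) (p, s) = (Suc p + clen c2, s1)"
    using run_Suc_code_at[OF *(1)] IfRF by simp
  moreover have "step P (Suc p + clen c2, s1) = (p + clen c2 + 2 + clen c1, s1)"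
    using run_Suc_code_at[OF *(3), of s1 "p + clen c2 + 2 + clen c1" s1 0] by simp
  ultimately show ?case by (simp add: algebra_simps)
next
  case (WhileF s a b c)
  then have "code_at P p [JumpILe b a (p + clen c + 2)]"
    by (auto simp: code_at_Cons[of _ _ _ "_ @ _"])
  from run_Suc_code_at[OF this, of s "p + clen c + 2" s 0] WhileF show ?case by simp
next
  case (WhileT s a b c k s1 l s2)
  then have *: "code_at P p [JumpILe b a (p + clen c + 2)]"
    "code_at P (Suc p) (compile (Suc p) c)" "code_at P (Suc p + clen c) [JumpILe 0 0 p]"
    by (auto simp: code_at_append code_at_Cons[of _ _ _ "_ @ _"])
  have "(step P ^^ k) (Suc p, s) = (Suc p + clen c, s1)"
    using WhileT * by simp
  then have "(step P ^^ Suc k) (p, s) = (Suc p + clen c, s1)"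
    using run_Suc_code_at[OF *(1)] WhileT by simp
  moreover have "step P (Suc p + clen c, s1) = (p, s1)"
    using run_Suc_code_at[OF *(3), of s1 p s1 0] by simp
  ultimately have "(step P ^^ Suc (Suc k)) (p, s) = (p, s1)"
    by simp
  moreover have "(step P ^^ l) (p, s1) = (p + clen (While a b c), s2)"
    using WhileT by blast
  ultimately have "(step P ^^ (l + Suc (Suc k))) (p, s) = (p + clen (While a b c), s2)"
    unfolding funpow_add by (simp only: o_apply)
  then show ?case by (simp add: algebra_simps)
qed

text \<open>Total correctness with a step bound: a derivation of \<open>big\<close> exists only for
  a terminating run.\<close>

definition triple :: "(memory \<Rightarrow> bool) \<Rightarrow> com \<Rightarrow> (memory \<Rightarrow> bool) \<Rightarrow> nat \<Rightarrow> bool" where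
  "triple Pre c Post T \<longleftrightarrow> (\<forall>s. Pre s \<longrightarrow> (\<exists>k s'. big c s k s' \<and> k \<le> T \<and> Post s'))"

lemma triple_conseq:
  assumes "triple Pre c Post T" "\<And>s. Pre' s \<Longrightarrow> Pre s" "\<And>s. Post s \<Longrightarrow> Post' s" "T \<le> T'"
  shows "triple Pre' c Post' T'"
  using assms unfolding triple_def by (meson order_trans)

lemma triple_Seq:
  assumes "triple P c1 Q T1" "triple Q c2 R T2"
  shows "triple P (c1 ;; c2) R (T1 + T2)"
  unfolding triple_def
proof (intro allI impI)
  fix s assume "P s"
  then obtain k s1 l s2 where "big c1 s k s1" "k \<le> T1" "big c2 s1 l s2" "l \<le> T2" "R s2"
    using assms unfolding triple_def by blast
  then show "\<exists>k s'. big (c1 ;; c2) s k s' \<and> k \<le> T1 + T2 \<and> R s'"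
    using big.Seq by (intro exI[of _ "k + l"] exI[of _ s2]) simp
qed

lemma triple_IfI:
  assumes "triple (\<lambda>s. P s \<and> fst s a \<le> fst s b) c1 Q T1"
    "triple (\<lambda>s. P s \<and> \<not> fst s a \<le> fst s b) c2 Q T2"
  shows "triple P (IfI a b c1 c2) Q (T1 + T2 + 2)"
  unfolding triple_def
proof (intro allI impI)
  fix s assume "P s"
  show "\<exists>k s'. big (IfI a b c1 c2) s k s' \<and> k \<le> T1 + T2 + 2 \<and> Q s'"
  proof (cases "fst s a \<le> fst s b")
    case True
    then obtain k s' where "big c1 s k s'" "k \<le> T1" "Q s'"
      using assms(1) \<open>P s\<close> unfolding triple_def by blast
    then show ?thesis using True big.IfIT by (intro exI[of _ "Suc k"] exI[of _ s']) auto
  next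
    case False
    then obtain k s' where "big c2 s k s'" "k \<le> T2" "Q s'"
      using assms(2) \<open>P s\<close> unfolding triple_def by blast
    then show ?thesis using False big.IfIF by (intro exI[of _ "Suc (Suc k)"] exI[of _ s']) auto
  qed
qed

text \<open>Every loop of the program counts up to a fixed bound, so the index of the invariant can
  be read off register \<open>a\<close> and also decides the loop test. The 2 per round is the test
  and the jump back, the final 1 the failing test.\<close>

lemma triple_While:
  assumes body: "\<And>k. k < n \<Longrightarrow> triple (Inv k) c (Inv (Suc k)) T"
    and regs: "\<And>k s. Inv k s \<Longrightarrow> k \<le> n \<Longrightarrow> fst s a = int k \<and> fst s b = int n"
  shows "triple (Inv 0) (While a b c) (Inv n) (n * (T + 2) + 1)"
proof -
  have "triple (Inv k) (While a b c) (Inv n) ((n - k) * (T + 2) + 1)" if "k \<le> n" for k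
    using that
  proof (induction "n - k" arbitrary: k)
    case 0
    show ?case unfolding triple_def
    proof (intro allI impI)
      fix s assume "Inv k s"
      then show "\<exists>l s'. big (While a b c) s l s' \<and> l \<le> (n - k) * (T + 2) + 1 \<and> Inv n s'"
        using 0 regs[of k s] big.WhileF[of s a b c] by (intro exI[of _ 1] exI[of _ s]) auto
    qed
  next
    case (Suc m)
    have k: "k < n" using Suc by simp
    show ?case unfolding triple_def
    proof (intro allI impI)
      fix s assume s: "Inv k s"
      obtain k1 s1 where 1: "big c s k1 s1" "k1 \<le> T" "Inv (Suc k) s1"
        using body[OF k] s unfolding triple_def by blast
      have "triple (Inv (Suc k)) (While a b c) (Inv n) ((n - Suc k) * (T + 2) + 1)"
        using Suc.hyps(1)[of "Suc k"] Suc.hyps(2) k by simp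
      then obtain k2 s2 where 2: "big (While a b c) s1 k2 s2"
        "k2 \<le> (n - Suc k) * (T + 2) + 1" "Inv n s2"
        using 1(3) unfolding triple_def by blast
      have "fst s a < fst s b" using regs[OF s] k by simp
      then have "big (While a b c) s (k1 + k2 + 2) s2" using 1(1) 2(1) by (rule big.WhileT)
      moreover have "n - k = Suc (n - Suc k)" using k by simp
      then have "k1 + k2 + 2 \<le> (n - k) * (T + 2) + 1" using 1(2) 2(2) by simp
      ultimately show "\<exists>l s'. big (While a b c) s l s' \<and> l \<le> (n - k) * (T + 2) + 1 \<and> Inv n s'"
        using 2(3) by (intro exI[of _ "k1 + k2 + 2"] exI[of _ s2]) blast
    qed
  qed
  from this[of 0] show ?thesis by simp
qed

text \<open>Meaningful for loop-free code only: \<open>den\<close> skips loops.\<close>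

fun den :: "com \<Rightarrow> memory \<Rightarrow> memory" where
  "den (Bas is) s = fold eff is s"
| "den (c1 ;; c2) s = den c2 (den c1 s)"
| "den (IfI a b c1 c2) s = (if fst s a \<le> fst s b then den c1 s else den c2 s)"
| "den (IfR a b c1 c2) s = (if snd s a \<le> snd s b then den c1 s else den c2 s)"
| "den (While a b c) s = s"

fun loop_free :: "com \<Rightarrow> bool" where
  "loop_free (Bas is) = True"
| "loop_free (c1 ;; c2) = (loop_free c1 \<and> loop_free c2)"
| "loop_free (IfI a b c1 c2) = (loop_free c1 \<and> loop_free c2)"
| "loop_free (IfR a b c1 c2) = (loop_free c1 \<and> loop_free c2)"
| "loop_free (While a b c) = False"

lemma big_den: "loop_free c \<Longrightarrow> \<exists>k \<le> clen c. big c s k (den c s)"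
proof (induction c arbitrary: s)
  case (Bas x)
  show ?case using big.Bas[of x s] by (intro exI[of _ "length x"]) simp
next
  case (Seq c1 c2)
  then obtain k l where "k \<le> clen c1" "big c1 s k (den c1 s)"
    "l \<le> clen c2" "big c2 (den c1 s) l (den c2 (den c1 s))"
    by (meson loop_free.simps(2))
  then show ?case using big.Seq[of c1 s k "den c1 s" c2 l] by (intro exI[of _ "k + l"]) auto
next
  case (IfI a b c1 c2)
  then obtain k l where *: "k \<le> clen c1" "big c1 s k (den c1 s)" "l \<le> clen c2" "big c2 s l (den c2 s)"
    by (meson loop_free.simps(3))
  show ?case
  proof (cases "fst s a \<le> fst s b")
    case True
    with * big.IfIT[of s a b c1 k _ c2] show ?thesis by (intro exI[of _ "Suc k"]) simp
  next
    case False
    with * big.IfIF[of s a b c2 l _ c1] show ?thesis by (intro exI[of _ "Suc (Suc l)"]) simp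
  qed
next
  case (IfR a b c1 c2)
  then obtain k l where *: "k \<le> clen c1" "big c1 s k (den c1 s)" "l \<le> clen c2" "big c2 s l (den c2 s)"
    by (meson loop_free.simps(4))
  show ?case
  proof (cases "snd s a \<le> snd s b")
    case True
    with * big.IfRT[of s a b c1 k _ c2] show ?thesis by (intro exI[of _ "Suc k"]) simp
  next
    case False
    with * big.IfRF[of s a b c2 l _ c1] show ?thesis by (intro exI[of _ "Suc (Suc l)"]) simp
  qed
qed simp

text \<open>Without loops each instruction is executed at most once, so the code length bounds the
  time, and the remaining goal about \<open>den\<close> is symbolic execution by rewriting.\<close>

lemma triple_loop_free:
  assumes "loop_free c" "clen c \<le> T" "\<And>I R. P (I, R) \<Longrightarrow> Q (den c (I, R))"
  shows "triple P c Q T"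
  unfolding triple_def
proof (intro allI impI)
  fix s assume "P s"
  then have "Q (den c s)" using assms(3) by (cases s) simp
  with big_den[OF assms(1), of s] assms(2)
  show "\<exists>k s'. big c s k s' \<and> k \<le> T \<and> Q s'" by (meson order_trans)
qed

section \<open>The greedy algorithm and its price bound\<close>

text \<open>Of the ordered pairs \<open>(j, l)\<close> and \<open>(l, j)\<close> at most one is
  counted, so twice the left side is at most the sum of \<open>w j + w l\<close> over all ordered
  pairs.\<close>

lemma sum_earlier_pairs_le:
  fixes \<tau> :: "nat \<Rightarrow> nat" and w :: "nat \<Rightarrow> real"
  assumes "finite S" "\<And>l. l \<in> S \<Longrightarrow> 0 \<le> w l"
  shows "(\<Sum>j\<in>S. \<Sum>l\<in>S. if \<tau> l < \<tau> j then w j + w l else 0) \<le> real (card S) * sum w S"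
proof -
  let ?g = "\<lambda>j l. if \<tau> l < \<tau> j then w j + w l else 0"
  have "2 * (\<Sum>j\<in>S. \<Sum>l\<in>S. ?g j l) = (\<Sum>j\<in>S. \<Sum>l\<in>S. ?g j l) + (\<Sum>j\<in>S. \<Sum>l\<in>S. ?g l j)"
    using sum.swap[of ?g S S] by simp
  also have "\<dots> = (\<Sum>j\<in>S. \<Sum>l\<in>S. ?g j l + ?g l j)"
    by (simp add: sum.distrib)
  also have "\<dots> \<le> (\<Sum>j\<in>S. \<Sum>l\<in>S. w j + w l)"
    by (intro sum_mono) (use assms(2) in auto)
  also have "\<dots> = 2 * (real (card S) * sum w S)"
    by (simp add: sum.distrib sum_distrib_left)
  finally show ?thesis by simp
qed

section \<open>Greedy states and the prices paid in them\<close>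

locale metric_cuftra =
  fixes nF nC :: nat and f :: "nat \<Rightarrow> real" and u :: "nat \<Rightarrow> nat" and c :: "nat \<Rightarrow> nat \<Rightarrow> real"
  assumes nF_pos: "0 < nF"
    and f_nonneg: "i < nF \<Longrightarrow> 0 \<le> f i"
    and u_pos: "i < nF \<Longrightarrow> 0 < u i"
    and c_nonneg: "i < nF \<Longrightarrow> j < nC \<Longrightarrow> 0 \<le> c i j"
    and metric: "i < nF \<Longrightarrow> i' < nF \<Longrightarrow> j < nC \<Longrightarrow> j' < nC \<Longrightarrow> c i j \<le> c i j' + c i' j' + c i' j"
begin

text \<open>Spreading the cost of a copy over its capacity turns capacities into a surcharge on
  connections, at the price of one extra opening per used site.\<close>

definition h :: "nat \<Rightarrow> real" where
  "h i = f i / real (u i)"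

definition d :: "nat \<Rightarrow> nat \<Rightarrow> real" where
  "d i j = c i j + h i"

lemma h_nonneg: "i < nF \<Longrightarrow> 0 \<le> h i"
  using f_nonneg by (simp add: h_def)

text \<open>A state of the greedy algorithm: \<open>\<phi>\<close> is the partial assignment of clients, \<open>g\<close> the remaining
  opening costs (\<open>0\<close> once a site is open).\<close>

definition unconn :: "(nat \<Rightarrow> nat option) \<Rightarrow> nat set" where
  "unconn \<phi> = {j. j < nC \<and> \<phi> j = None}"

definition saving :: "(nat \<Rightarrow> nat option) \<Rightarrow> nat \<Rightarrow> nat \<Rightarrow> real" where
  "saving \<phi> i j = (case \<phi> j of None \<Rightarrow> 0 | Some i' \<Rightarrow> max 0 (d i' j - d i j))"

definition gap :: "(nat \<Rightarrow> nat option) \<Rightarrow> (nat \<Rightarrow> real) \<Rightarrow> nat \<Rightarrow> real" where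
  "gap \<phi> g i = g i - (\<Sum>j<nC. saving \<phi> i j)"

definition reassign :: "(nat \<Rightarrow> nat option) \<Rightarrow> nat \<Rightarrow> nat set \<Rightarrow> nat \<Rightarrow> nat option" where
  "reassign \<phi> i B j = (if j \<in> B then Some i else
     case \<phi> j of None \<Rightarrow> None | Some i' \<Rightarrow> if d i' j \<le> d i j then Some i' else Some i)"

definition conn_cost :: "(nat \<Rightarrow> nat option) \<Rightarrow> nat \<Rightarrow> real" where
  "conn_cost \<phi> j = (case \<phi> j of None \<Rightarrow> 0 | Some i \<Rightarrow> d i j)"

text \<open>\<open>\<alpha>\<close> is the price paid by a client, \<open>\<tau>\<close> the iteration in which it got connected.\<close>

definition priced :: "(nat \<Rightarrow> nat option) \<Rightarrow> nat \<Rightarrow> (nat \<Rightarrow> real) \<Rightarrow> (nat \<Rightarrow> nat) \<Rightarrow> nat \<Rightarrow> bool" where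
  "priced \<phi> it \<alpha> \<tau> j \<longleftrightarrow> \<tau> j < it \<and>
     (\<forall>i<nF. \<forall>S\<subseteq>{..<nC}. j \<in> S \<longrightarrow>
       real (card S) * \<alpha> j \<le> f i + (\<Sum>l\<in>S. h i +
         (if l \<notin> unconn \<phi> \<and> \<tau> l < \<tau> j then c i j + 2 * c i l else c i l)))"

text \<open>Prices and times are quantified existentially because they serve the analysis only; the
  program stores neither.\<close>

definition greedy_state :: "nat \<Rightarrow> (nat \<Rightarrow> nat option) \<Rightarrow> (nat \<Rightarrow> real) \<Rightarrow> bool" where
  "greedy_state it \<phi> g \<longleftrightarrow>
     (\<forall>i<nF. 0 \<le> g i \<and> g i \<le> f i) \<and>
     (\<forall>j<nC. \<forall>i. \<phi> j = Some i \<longrightarrow> i < nF \<and> g i = 0) \<and>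
     (\<exists>\<alpha> \<tau>. (\<Sum>i<nF. f i - g i) + (\<Sum>j<nC. conn_cost \<phi> j) \<le> (\<Sum>j\<in>{..<nC} - unconn \<phi>. \<alpha> j) \<and>
       (\<forall>j\<in>{..<nC} - unconn \<phi>. priced \<phi> it \<alpha> \<tau> j))"

lemma finite_unconn [simp]: "finite (unconn \<phi>)"
  by (simp add: unconn_def)

lemma unconn_subset: "unconn \<phi> \<subseteq> {..<nC}"
  by (auto simp: unconn_def)

lemma greedy_state_init: "greedy_state 0 (\<lambda>j. None) f"
proof -
  have none: "{..<nC} - unconn (\<lambda>j. None) = {}" by (auto simp: unconn_def)
  show ?thesis unfolding greedy_state_def none by (simp add: conn_cost_def f_nonneg)
qed

lemma unconn_reassign: "unconn (reassign \<phi> i B) = unconn \<phi> - B"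
  by (auto simp: unconn_def reassign_def split: option.splits if_splits)

text \<open>Minimality of \<open>t\<close> is used twice: for the star \<open>{j}\<close> at the
  present site of each connected \<open>l\<close> in \<open>S\<close>, which shows how much
  \<open>l\<close> would save at \<open>i\<close>, and for the unconnected part of \<open>S\<close>
  at \<open>i\<close> itself.\<close>

lemma new_price:
  assumes it: "greedy_state it \<phi> g"
    and min: "\<And>i B. i < nF \<Longrightarrow> B \<subseteq> unconn \<phi> \<Longrightarrow> B \<noteq> {} \<Longrightarrow>
      t * real (card B) \<le> gap \<phi> g i + (\<Sum>j\<in>B. d i j)"
    and i: "i < nF" and S: "S \<subseteq> {..<nC}" and j: "j \<in> S" "j \<in> unconn \<phi>"
  shows "real (card S) * t \<le> f i + (\<Sum>l\<in>S. h i + (if l \<notin> unconn \<phi> then c i j + 2 * c i l else c i l))"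
proof -
  let ?B = "S \<inter> unconn \<phi>" and ?N = "S - unconn \<phi>"
  have fin: "finite S" using S finite_subset by blast
  have jC: "j < nC" using S j by auto
  have split: "sum w S = sum w ?B + sum w ?N" for w :: "nat \<Rightarrow> real"
    using fin sum.Int_Diff by blast
  have near: "t - c i j - 2 * c i l - h i \<le> saving \<phi> i l" if l: "l \<in> ?N" for l
  proof -
    have lC: "l < nC" using S l by auto
    then obtain i' where i': "\<phi> l = Some i'" using l by (auto simp: unconn_def)
    then have i'F: "i' < nF" "g i' = 0" using it lC by (auto simp: greedy_state_def)
    \<comment> \<open>The site \<open>i'\<close> is open, so its gap is at most 0 and the single
      client \<open>j\<close> is a star there of ratio at most \<open>d i' j\<close>.\<close>
    have "t * real (card {j}) \<le> gap \<phi> g i' + (\<Sum>j\<in>{j}. d i' j)"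
      using min[of i' "{j}"] i'F j by blast
    moreover have "gap \<phi> g i' \<le> 0"
      using i'F by (auto simp: gap_def saving_def intro!: sum_nonneg split: option.splits)
    ultimately have "t \<le> c i' j + h i'" by (simp add: d_def)
    also have "\<dots> \<le> c i' l + c i l + c i j + h i'" using metric[OF i'F(1) i jC lC] by simp
    \<comment> \<open>The surcharge \<open>h i'\<close> is also contained in \<open>d i' l\<close>
      and cancels.\<close>
    finally have "t - c i j - 2 * c i l - h i \<le> d i' l - d i l" by (simp add: d_def)
    then show ?thesis by (simp add: saving_def i')
  qed
  have "(\<Sum>l\<in>?N. t - c i j - 2 * c i l - h i) \<le> (\<Sum>l\<in>?N. saving \<phi> i l)"
    using near by (rule sum_mono)
  also have "\<dots> \<le> (\<Sum>l<nC. saving \<phi> i l)"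
    using S by (intro sum_mono2) (auto simp: saving_def split: option.splits)
  also have "\<dots> \<le> f i - gap \<phi> g i"
    using it i by (auto simp: gap_def greedy_state_def)
  also have "\<dots> \<le> f i + (\<Sum>l\<in>?B. d i l - t)"
  proof -
    have "?B \<noteq> {}" using j by blast
    then show ?thesis using min[OF i, of ?B] by (simp add: sum_subtractf mult.commute)
  qed
  finally have "(\<Sum>l\<in>?N. t - c i j - 2 * c i l - h i) + (\<Sum>l\<in>?B. t - d i l) \<le> f i"
    by (simp add: sum_subtractf)
  moreover have "(\<Sum>l\<in>S. t - h i - (if l \<notin> unconn \<phi> then c i j + 2 * c i l else c i l)) =
    (\<Sum>l\<in>?B. t - d i l) + (\<Sum>l\<in>?N. t - c i j - 2 * c i l - h i)"
    unfolding split by (intro arg_cong2[where f = "(+)"] sum.cong) (auto simp: d_def)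
  ultimately show ?thesis by (simp add: sum_subtractf sum.distrib algebra_simps)
qed

lemma conn_cost_reassign:
  assumes "j < nC" "B \<subseteq> unconn \<phi>"
  shows "conn_cost (reassign \<phi> i B) j = conn_cost \<phi> j - saving \<phi> i j + (if j \<in> B then d i j else 0)"
  using assms by (auto simp: conn_cost_def reassign_def saving_def unconn_def split: option.splits)

text \<open>The cost grows by \<open>g i\<close>, minus the savings, plus the connections of
  \<open>B\<close>; by the choice of \<open>t\<close> this is exactly what the clients of
  \<open>B\<close> pay.\<close>

lemma greedy_state_step:
  assumes it: "greedy_state it \<phi> g"
    and min: "\<And>i B. i < nF \<Longrightarrow> B \<subseteq> unconn \<phi> \<Longrightarrow> B \<noteq> {} \<Longrightarrow>
      t * real (card B) \<le> gap \<phi> g i + (\<Sum>j\<in>B. d i j)"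
    and i: "i < nF" and B: "B \<subseteq> unconn \<phi>"
    and eq: "t * real (card B) = gap \<phi> g i + (\<Sum>j\<in>B. d i j)"
  shows "greedy_state (Suc it) (reassign \<phi> i B) (g(i := 0))"
proof -
  let ?\<phi> = "reassign \<phi> i B" and ?g = "g(i := 0)"
  obtain \<alpha> \<tau> where cost: "(\<Sum>i<nF. f i - g i) + (\<Sum>j<nC. conn_cost \<phi> j) \<le> (\<Sum>j\<in>{..<nC} - unconn \<phi>. \<alpha> j)"
    and pr: "\<And>j. j \<in> {..<nC} - unconn \<phi> \<Longrightarrow> priced \<phi> it \<alpha> \<tau> j"
    and gf: "\<And>i. i < nF \<Longrightarrow> 0 \<le> g i \<and> g i \<le> f i"
    and opened: "\<And>i j. j < nC \<Longrightarrow> \<phi> j = Some i \<Longrightarrow> i < nF \<and> g i = 0"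
    using it unfolding greedy_state_def by blast
  define \<alpha>' where "\<alpha>' j = (if j \<in> B then t else \<alpha> j)" for j
  define \<tau>' where "\<tau>' j = (if j \<in> B then it else \<tau> j)" for j
  have BC: "B \<subseteq> {..<nC}" using B unconn_subset by blast
  then have finB: "finite B" using finite_subset by blast
  have "(\<Sum>i<nF. f i - ?g i) = (\<Sum>i<nF. f i - g i) + g i"
    using i by (simp add: sum_subtractf sum.remove[of "{..<nF}" i])
  moreover have "(\<Sum>j<nC. conn_cost ?\<phi> j) =
    (\<Sum>j<nC. conn_cost \<phi> j) - (\<Sum>j<nC. saving \<phi> i j) + (\<Sum>j\<in>B. d i j)"
  proof -
    have "(\<Sum>j<nC. conn_cost ?\<phi> j) =
      (\<Sum>j<nC. conn_cost \<phi> j - saving \<phi> i j + (if j \<in> B then d i j else 0))"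
      using B by (intro sum.cong) (auto simp: conn_cost_reassign)
    also have "\<dots> = (\<Sum>j<nC. conn_cost \<phi> j) - (\<Sum>j<nC. saving \<phi> i j) + (\<Sum>j\<in>{..<nC} \<inter> B. d i j)"
      by (simp add: sum.distrib sum_subtractf sum.inter_restrict)
    also have "{..<nC} \<inter> B = B" using BC by blast
    finally show ?thesis .
  qed
  moreover have "(\<Sum>j\<in>{..<nC} - unconn ?\<phi>. \<alpha>' j) = (\<Sum>j\<in>{..<nC} - unconn \<phi>. \<alpha> j) + t * real (card B)"
  proof -
    have "{..<nC} - unconn ?\<phi> = ({..<nC} - unconn \<phi>) \<union> B"
      using BC by (auto simp: unconn_reassign)
    then have "(\<Sum>j\<in>{..<nC} - unconn ?\<phi>. \<alpha>' j) = (\<Sum>j\<in>{..<nC} - unconn \<phi>. \<alpha>' j) + (\<Sum>j\<in>B. \<alpha>' j)"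
      using B finB by (simp add: sum.union_disjoint Int_commute disjoint_iff subset_iff)
    also have "(\<Sum>j\<in>{..<nC} - unconn \<phi>. \<alpha>' j) = (\<Sum>j\<in>{..<nC} - unconn \<phi>. \<alpha> j)"
      using B by (intro sum.cong) (auto simp: \<alpha>'_def)
    also have "(\<Sum>j\<in>B. \<alpha>' j) = t * real (card B)" by (simp add: \<alpha>'_def)
    finally show ?thesis .
  qed
  ultimately have cost': "(\<Sum>i<nF. f i - ?g i) + (\<Sum>j<nC. conn_cost ?\<phi> j) \<le>
      (\<Sum>j\<in>{..<nC} - unconn ?\<phi>. \<alpha>' j)"
    using cost eq by (simp add: gap_def)
  have pr': "priced ?\<phi> (Suc it) \<alpha>' \<tau>' j" if j: "j \<in> {..<nC} - unconn ?\<phi>" for j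
  proof (cases "j \<in> B")
    case True
    \<comment> \<open>All of \<open>B\<close> receives time \<open>it\<close>, which exceeds every
      older time, so the clients earlier than \<open>j\<close> are exactly those connected before
      this iteration.\<close>
    have early: "(l \<notin> unconn ?\<phi> \<and> \<tau>' l < \<tau>' j) = (l \<notin> unconn \<phi>)" if "l < nC" for l
    proof -
      have "\<tau> l < it" if "l \<notin> unconn \<phi>" using pr[of l] that \<open>l < nC\<close> by (simp add: priced_def)
      then show ?thesis using True B by (auto simp: \<tau>'_def unconn_reassign)
    qed
    have "real (card S) * t \<le> f k + (\<Sum>l\<in>S. h k +
        (if l \<notin> unconn ?\<phi> \<and> \<tau>' l < \<tau>' j then c k j + 2 * c k l else c k l))"
      if "k < nF" "S \<subseteq> {..<nC}" "j \<in> S" for k S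
    proof -
      have "(\<Sum>l\<in>S. h k + (if l \<notin> unconn ?\<phi> \<and> \<tau>' l < \<tau>' j then c k j + 2 * c k l else c k l)) =
        (\<Sum>l\<in>S. h k + (if l \<notin> unconn \<phi> then c k j + 2 * c k l else c k l))"
        using that(2) by (intro sum.cong refl) (simp add: early subset_iff)
      then show ?thesis using new_price[OF it min that] True B by auto
    qed
    then show ?thesis using True by (simp add: priced_def \<alpha>'_def \<tau>'_def)
  next
    case False
    then have j': "j \<in> {..<nC} - unconn \<phi>" using j by (auto simp: unconn_reassign)
    have \<tau>j: "\<tau> j < it" using pr[OF j'] by (simp add: priced_def)
    \<comment> \<open>A client connected just now was excluded before as unconnected and is excluded
      from now on as later than \<open>j\<close>. Old price inequalities therefore survive
      literally.\<close>
    have early: "(l \<notin> unconn ?\<phi> \<and> \<tau>' l < \<tau>' j) = (l \<notin> unconn \<phi> \<and> \<tau> l < \<tau> j)" for l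
      using False \<tau>j B by (auto simp: \<tau>'_def unconn_reassign)
    show ?thesis
      using pr[OF j'] False unfolding priced_def early by (simp add: \<alpha>'_def \<tau>'_def)
  qed
  show ?thesis
    unfolding greedy_state_def
  proof (intro conjI)
    show "\<forall>i'<nF. 0 \<le> ?g i' \<and> ?g i' \<le> f i'" using gf f_nonneg by auto
    show "\<forall>j<nC. \<forall>i'. ?\<phi> j = Some i' \<longrightarrow> i' < nF \<and> ?g i' = 0"
      using i opened by (auto simp: reassign_def split: option.splits if_splits)
    show "\<exists>\<alpha> \<tau>. (\<Sum>i<nF. f i - ?g i) + (\<Sum>j<nC. conn_cost ?\<phi> j) \<le> (\<Sum>j\<in>{..<nC} - unconn ?\<phi>. \<alpha> j) \<and>
       (\<forall>j\<in>{..<nC} - unconn ?\<phi>. priced ?\<phi> (Suc it) \<alpha> \<tau> j)"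
      using cost' pr' by blast
  qed
qed

text \<open>Summing the inequalities of \<open>priced\<close> over all \<open>j\<close> in
  \<open>S\<close> gives \<open>card S\<close> times the claim, once the excess of the ordered pairs
  is bounded by \<open>sum_earlier_pairs_le\<close>.\<close>

lemma price_bound:
  assumes pr: "\<And>j. j < nC \<Longrightarrow> priced \<phi> it \<alpha> \<tau> j" and conn: "unconn \<phi> = {}"
    and i: "i < nF" and S: "S \<subseteq> {..<nC}"
  shows "sum \<alpha> S \<le> f i + real (card S) * h i + 2 * (\<Sum>j\<in>S. c i j)"
proof (cases "S = {}")
  case True
  then show ?thesis using f_nonneg[OF i] by simp
next
  case False
  have fin: "finite S" using S finite_subset by blast
  let ?k = "real (card S)"
  have k: "?k > 0" using False fin by (simp add: card_gt_0_iff)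
  have "?k * sum \<alpha> S = (\<Sum>j\<in>S. ?k * \<alpha> j)" by (simp add: sum_distrib_left)
  also have "\<dots> \<le> (\<Sum>j\<in>S. f i + (\<Sum>l\<in>S. h i + (if \<tau> l < \<tau> j then c i j + 2 * c i l else c i l)))"
    using pr S i conn by (intro sum_mono) (auto simp: priced_def subset_iff)
  also have "\<dots> = (\<Sum>j\<in>S. f i + (\<Sum>l\<in>S. h i + c i l + (if \<tau> l < \<tau> j then c i j + c i l else 0)))"
    by (intro sum.cong refl arg_cong[where f = "(+) (f i)"]) auto
  also have "\<dots> = ?k * f i + ?k * (?k * h i) + ?k * (\<Sum>j\<in>S. c i j) +
      (\<Sum>j\<in>S. \<Sum>l\<in>S. if \<tau> l < \<tau> j then c i j + c i l else 0)"
    by (simp add: sum.distrib distrib_left)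
  also have "\<dots> \<le> ?k * f i + ?k * (?k * h i) + ?k * (\<Sum>j\<in>S. c i j) + ?k * (\<Sum>j\<in>S. c i j)"
    using sum_earlier_pairs_le[OF fin, of "c i" \<tau>] c_nonneg[OF i] S by (simp add: subset_iff)
  also have "\<dots> = ?k * (f i + ?k * h i + 2 * (\<Sum>j\<in>S. c i j))" by (simp add: algebra_simps)
  finally show ?thesis using k by simp
qed

text \<open>Prices may be negative, so weak duality is applied to their positive parts.\<close>

lemma price_sum_le:
  assumes bound: "\<And>i S. i < nF \<Longrightarrow> S \<subseteq> {..<nC} \<Longrightarrow>
      sum \<alpha> S \<le> f i + real (card S) * h i + 2 * (\<Sum>j\<in>S. c i j)"
    and feas: "feasible nF nC u r y x" and r: "\<And>j. j < nC \<Longrightarrow> r j = rr"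
  shows "real rr * sum \<alpha> {..<nC} \<le> 2 * total_cost nF nC f c y x"
proof -
  have y0: "0 \<le> y i" and cap: "(\<Sum>j<nC. x i j) \<le> int (u i) * y i" if "i < nF" for i
    using feas that by (auto simp: feasible_def)
  have x0: "0 \<le> x i j" and xy: "x i j \<le> y i" if "i < nF" "j < nC" for i j
    using feas that by (auto simp: feasible_def)
  have req: "int rr \<le> (\<Sum>i<nF. x i j)" if "j < nC" for j
    using feas that r by (auto simp: feasible_def)
  let ?\<beta> = "\<lambda>j. max (\<alpha> j) 0"
  have site: "(\<Sum>j<nC. ?\<beta> j * real_of_int (x i j)) \<le>
      2 * (f i * real_of_int (y i)) + 2 * (\<Sum>j<nC. c i j * real_of_int (x i j))" if i: "i < nF" for i
  proof -
    \<comment> \<open>What remains of the price of \<open>j\<close> after its surcharge and twice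
      its connection cost. Only clients with a positive remainder are kept; for them
      \<open>x i j\<close> may be raised to \<open>y i\<close>, which makes the price bound for
      \<open>?S\<close> applicable.\<close>
    let ?w = "\<lambda>j. ?\<beta> j - h i - 2 * c i j"
    let ?S = "{j. j < nC \<and> 0 < ?w j}"
    have "?w j * real_of_int (x i j) \<le> (if 0 < ?w j then (\<alpha> j - h i - 2 * c i j) * real_of_int (y i) else 0)"
      if j: "j < nC" for j
    proof (cases "0 < ?w j")
      case True
      \<comment> \<open>A positive remainder forces a positive price, as \<open>h i\<close> and
        \<open>c i j\<close> are nonnegative.\<close>
      then have "?\<beta> j = \<alpha> j" using h_nonneg[OF i] c_nonneg[OF i j] by (auto simp: max_def split: if_splits)
      then show ?thesis using True xy[OF i j] by (simp add: mult_left_mono)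
    next
      case False
      then show ?thesis using x0[OF i j] by (simp add: mult_nonpos_nonneg)
    qed
    then have "(\<Sum>j<nC. ?w j * real_of_int (x i j)) \<le>
        (\<Sum>j<nC. if 0 < ?w j then (\<alpha> j - h i - 2 * c i j) * real_of_int (y i) else 0)"
      by (intro sum_mono) auto
    also have "\<dots> = (\<Sum>j\<in>?S. (\<alpha> j - h i - 2 * c i j) * real_of_int (y i))"
      by (simp add: sum.If_cases lessThan_def Int_def)
    also have "\<dots> = (sum \<alpha> ?S - real (card ?S) * h i - 2 * (\<Sum>j\<in>?S. c i j)) * real_of_int (y i)"
      by (simp add: sum_distrib_right[symmetric] sum_subtractf sum_distrib_left)
    also have "\<dots> \<le> f i * real_of_int (y i)"
    proof (rule mult_right_mono)
      have "?S \<subseteq> {..<nC}" by auto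
      then show "sum \<alpha> ?S - real (card ?S) * h i - 2 * (\<Sum>j\<in>?S. c i j) \<le> f i"
        using bound[OF i, of ?S] by linarith
    qed (use y0[OF i] in simp)
    finally have "(\<Sum>j<nC. ?\<beta> j * real_of_int (x i j)) \<le> f i * real_of_int (y i) +
        h i * (\<Sum>j<nC. real_of_int (x i j)) + 2 * (\<Sum>j<nC. c i j * real_of_int (x i j))"
      by (simp add: algebra_simps sum.distrib sum_subtractf sum_distrib_left)
    \<comment> \<open>The only use of the capacity constraint: the surcharges at \<open>i\<close>
      amount to at most one more opening cost per copy.\<close>
    moreover have "h i * (\<Sum>j<nC. real_of_int (x i j)) \<le> f i * real_of_int (y i)"
    proof -
      have "(\<Sum>j<nC. real_of_int (x i j)) \<le> real (u i) * real_of_int (y i)"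
        using cap[OF i] by (metis of_int_le_iff of_int_mult of_int_of_nat_eq of_int_sum)
      then have "h i * (\<Sum>j<nC. real_of_int (x i j)) \<le> h i * (real (u i) * real_of_int (y i))"
        using h_nonneg[OF i] by (rule mult_left_mono)
      then show ?thesis using u_pos[OF i] by (simp add: h_def)
    qed
    ultimately show ?thesis by simp
  qed
  have "real rr * sum \<alpha> {..<nC} \<le> (\<Sum>j<nC. ?\<beta> j * real rr)"
    by (simp add: sum_distrib_left mult.commute sum_mono mult_left_mono)
  also have "\<dots> \<le> (\<Sum>j<nC. ?\<beta> j * (\<Sum>i<nF. real_of_int (x i j)))"
  proof (intro sum_mono mult_left_mono)
    fix j assume "j \<in> {..<nC}"
    then show "real rr \<le> (\<Sum>i<nF. real_of_int (x i j))"
      using req[of j] by (metis lessThan_iff of_int_le_iff of_int_of_nat_eq of_int_sum)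
  qed simp
  also have "\<dots> = (\<Sum>i<nF. \<Sum>j<nC. ?\<beta> j * real_of_int (x i j))"
    by (simp add: sum_distrib_left sum.swap[of _ "{..<nC}"])
  also have "\<dots> \<le> (\<Sum>i<nF. 2 * (f i * real_of_int (y i)) + 2 * (\<Sum>j<nC. c i j * real_of_int (x i j)))"
    using site by (intro sum_mono) auto
  also have "\<dots> = 2 * total_cost nF nC f c y x"
    by (simp add: total_cost_def sum.distrib sum_distrib_left)
  finally show ?thesis .
qed

section \<open>Optimal stars as prefixes of the sorted clients\<close>

definition nearest_order :: "(nat \<Rightarrow> nat \<Rightarrow> nat) \<Rightarrow> bool" where
  "nearest_order p \<longleftrightarrow> (\<forall>i<nF. bij_betw (p i) {..<nC} {..<nC} \<and>
     (\<forall>k' k. k' \<le> k \<longrightarrow> k < nC \<longrightarrow> d i (p i k') \<le> d i (p i k)))"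

definition star :: "(nat \<Rightarrow> nat \<Rightarrow> nat) \<Rightarrow> (nat \<Rightarrow> nat option) \<Rightarrow> nat \<Rightarrow> nat \<Rightarrow> nat set" where
  "star p \<phi> i k = p i ` {k'. k' < k \<and> p i k' \<in> unconn \<phi>}"

lemma star_subset: "star p \<phi> i k \<subseteq> unconn \<phi>"
  by (auto simp: star_def)

lemma finite_star [simp]: "finite (star p \<phi> i k)"
  by (rule finite_subset[OF star_subset finite_unconn])

lemma star_0 [simp]: "star p \<phi> i 0 = {}"
  by (simp add: star_def)

lemma star_Suc: "star p \<phi> i (Suc k) =
    (if p i k \<in> unconn \<phi> then insert (p i k) (star p \<phi> i k) else star p \<phi> i k)"
  by (auto simp: star_def less_Suc_eq)

lemma nearest_order_bij: "nearest_order p \<Longrightarrow> i < nF \<Longrightarrow> bij_betw (p i) {..<nC} {..<nC}"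
  by (simp add: nearest_order_def)

lemma nearest_order_less: "nearest_order p \<Longrightarrow> i < nF \<Longrightarrow> k < nC \<Longrightarrow> p i k < nC"
  using bij_betwE[OF nearest_order_bij] by blast

lemma nearest_order_inj:
  "nearest_order p \<Longrightarrow> i < nF \<Longrightarrow> k < nC \<Longrightarrow> k' < nC \<Longrightarrow> p i k = p i k' \<longleftrightarrow> k = k'"
  by (rule inj_on_eq_iff[OF bij_betw_imp_inj_on[OF nearest_order_bij]]) simp_all

lemma nearest_order_surj:
  assumes "nearest_order p" "i < nF" "j < nC" obtains k where "k < nC" "p i k = j"
proof -
  have "j \<in> p i ` {..<nC}"
    using bij_betw_imp_surj_on[OF nearest_order_bij[OF assms(1,2)]] assms(3) by simp
  then show thesis using that by blast
qed

lemma in_star_iff: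
  assumes "nearest_order p" "i < nF" "k < nC" "k' \<le> nC"
  shows "p i k \<in> star p \<phi> i k' \<longleftrightarrow> p i k \<in> unconn \<phi> \<and> k < k'"
proof
  assume "p i k \<in> star p \<phi> i k'"
  then obtain l where l: "l < k'" "p i l = p i k" "p i k \<in> unconn \<phi>" by (auto simp: star_def)
  then have "l = k" using nearest_order_inj[OF assms(1,2), of l k] assms(3,4) by simp
  then show "p i k \<in> unconn \<phi> \<and> k < k'" using l by simp
qed (simp add: star_def)

text \<open>For fixed \<open>t\<close>, the set \<open>{j. d i j < t}\<close> maximises \<open>\<Sum>\<^sub>j\<^sub>\<in>\<^sub>B t - d i j\<close>, and it is a prefix of the
  order.\<close>

lemma star_ratio_min:
  assumes p: "nearest_order p" and i: "i < nF"
    and min: "\<And>k. k < nC \<Longrightarrow> p i k \<in> unconn \<phi> \<Longrightarrow>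
      t * real (card (star p \<phi> i (Suc k))) \<le> gap \<phi> g i + (\<Sum>j\<in>star p \<phi> i (Suc k). d i j)"
    and B: "B \<subseteq> unconn \<phi>" "B \<noteq> {}"
  shows "t * real (card B) \<le> gap \<phi> g i + (\<Sum>j\<in>B. d i j)"
proof -
  have mono: "d i (p i k') \<le> d i (p i k)" if "k' \<le> k" "k < nC" for k k'
    using p i that unfolding nearest_order_def by blast
  have ex: "\<exists>k<nC. p i k = j" if "j \<in> unconn \<phi>" for j
  proof -
    have "j < nC" using that by (simp add: unconn_def)
    then show ?thesis using nearest_order_surj[OF p i] by metis
  qed
  have finB: "finite B" using B(1) finite_unconn by (rule finite_subset)
  let ?M = "{j \<in> unconn \<phi>. d i j < t}"
  have "(\<Sum>j\<in>B. t - d i j) \<le> gap \<phi> g i"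
  proof (cases "?M = {}")
    case True
    \<comment> \<open>Here no term \<open>t - d i j\<close> is positive and the maximiser would be
      empty. As \<open>B\<close> is nonempty, it is compared with the nearest unconnected client
      alone, which is the shortest nonempty prefix.\<close>
    let ?K = "{k. k < nC \<and> p i k \<in> unconn \<phi>}"
    obtain b where b: "b \<in> B" using B by blast
    have "?K \<noteq> {}" using ex[of b] b B by blast
    define k where "k = Min ?K"
    have kK: "k \<in> ?K" using \<open>?K \<noteq> {}\<close> unfolding k_def by (intro Min_in) auto
    have le: "k \<le> k'" if "k' \<in> ?K" for k' using that unfolding k_def by (intro Min_le) auto
    have "{k'. k' < Suc k \<and> p i k' \<in> unconn \<phi>} = {k}"
      using kK le by (auto simp: less_Suc_eq_le intro: antisym dest: le_less_trans)
    then have "star p \<phi> i (Suc k) = {p i k}" by (simp add: star_def)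
    then have t: "t - d i (p i k) \<le> gap \<phi> g i" using min[of k] kK by simp
    obtain k' where k': "k' < nC" "p i k' = b" using ex b B by blast
    then have "k \<le> k'" using le b B by blast
    then have "t - d i b \<le> t - d i (p i k)" using mono k' by force
    moreover have "(\<Sum>j\<in>B - {b}. t - d i j) \<le> 0"
      using True B by (intro sum_nonpos) (auto simp: not_less subset_iff)
    ultimately show ?thesis using t sum.remove[OF finB b, of "\<lambda>j. t - d i j"] by linarith
  next
    case False
    \<comment> \<open>The farthest client of \<open>?M\<close> is where the prefix ends.\<close>
    let ?K = "{k. k < nC \<and> p i k \<in> ?M}"
    have "?K \<noteq> {}" using ex False by blast
    define k where "k = Max ?K"
    have kK: "k \<in> ?K" using \<open>?K \<noteq> {}\<close> unfolding k_def by (intro Max_in) auto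
    have le: "k' \<le> k" if "k' \<in> ?K" for k' using that unfolding k_def by (intro Max_ge) auto
    have "star p \<phi> i (Suc k) = ?M"
    proof (intro equalityI subsetI)
      fix j assume "j \<in> star p \<phi> i (Suc k)"
      then obtain k' where k': "k' \<le> k" "j = p i k'" "j \<in> unconn \<phi>"
        by (auto simp: star_def less_Suc_eq_le)
      then have "d i j \<le> d i (p i k)" using mono kK by blast
      then show "j \<in> ?M" using kK k' by auto
    next
      fix j assume j: "j \<in> ?M"
      then obtain k' where k': "k' < nC" "p i k' = j" using ex by blast
      then have "k' \<le> k" using le j by blast
      then show "j \<in> star p \<phi> i (Suc k)" using k' j by (auto simp: star_def less_Suc_eq_le)
    qed
    then have M: "(\<Sum>j\<in>?M. t - d i j) \<le> gap \<phi> g i"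
      using min[of k] kK by (simp add: sum_subtractf mult.commute)
    have "(\<Sum>j\<in>B. t - d i j) \<le> (\<Sum>j\<in>B. if d i j < t then t - d i j else 0)"
      by (intro sum_mono) auto
    also have "\<dots> = (\<Sum>j\<in>{j\<in>B. d i j < t}. t - d i j)"
      using finB by (simp add: sum.inter_filter)
    also have "\<dots> \<le> (\<Sum>j\<in>?M. t - d i j)"
      using B by (intro sum_mono2) auto
    finally show ?thesis using M by linarith
  qed
  then show ?thesis by (simp add: sum_subtractf mult.commute)
qed

section \<open>From an assignment to copies of sites\<close>

definition load :: "(nat \<Rightarrow> nat option) \<Rightarrow> nat \<Rightarrow> nat \<Rightarrow> nat" where
  "load \<phi> i j = card {l. l < j \<and> \<phi> l = Some i}"

lemma load_0 [simp]: "load \<phi> i 0 = 0"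
  by (simp add: load_def)

lemma load_Suc: "load \<phi> i (Suc j) = (if \<phi> j = Some i then Suc (load \<phi> i j) else load \<phi> i j)"
proof -
  have "{l. l < Suc j \<and> \<phi> l = Some i} = (if \<phi> j = Some i then insert j {l. l < j \<and> \<phi> l = Some i}
      else {l. l < j \<and> \<phi> l = Some i})"
    by (auto simp: less_Suc_eq)
  then show ?thesis by (simp add: load_def)
qed

lemma load_eq_sum: "real (load \<phi> i j) = (\<Sum>l<j. if \<phi> l = Some i then 1 else 0)"
  by (induction j) (auto simp: load_Suc)

text \<open>\<open>q i\<close> is \<open>load / u i\<close> rounded up, described without division:
  \<open>\<rho>\<close> counts the free places of the last copy, which is the form in which the
  program maintains it.\<close>

lemma greedy_solution:
  assumes st: "greedy_state it \<phi> g" and all: "unconn \<phi> = {}"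
    and r: "\<And>j. j < nC \<Longrightarrow> r j = rr"
    and q: "\<And>i. i < nF \<Longrightarrow> \<exists>\<rho><u i. q i * u i = load \<phi> i nC + \<rho>"
    and y: "\<And>i. i < nF \<Longrightarrow> y i = int rr * int (q i)"
    and x: "\<And>i j. i < nF \<Longrightarrow> j < nC \<Longrightarrow> x i j = (if \<phi> j = Some i then int rr else 0)"
  shows "feasible nF nC u r y x"
    and "feasible nF nC u r y' x' \<Longrightarrow> total_cost nF nC f c y x \<le> 2 * total_cost nF nC f c y' x'"
proof -
  obtain \<alpha> \<tau> where cost: "(\<Sum>i<nF. f i - g i) + (\<Sum>j<nC. conn_cost \<phi> j) \<le> (\<Sum>j<nC. \<alpha> j)"
    and pr: "\<And>j. j \<in> {..<nC} \<Longrightarrow> priced \<phi> it \<alpha> \<tau> j"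
    and gf: "\<And>i. i < nF \<Longrightarrow> g i \<le> f i"
    and opened: "\<And>i j. j < nC \<Longrightarrow> \<phi> j = Some i \<Longrightarrow> i < nF \<and> g i = 0"
    using st unfolding greedy_state_def all Diff_empty by blast
  have assigned: "\<exists>i<nF. \<phi> j = Some i" if "j < nC" for j
    using all that opened by (auto simp: unconn_def)
  have one_site: "(\<Sum>i<nF. if \<phi> j = Some i then w i else 0) = w (the (\<phi> j))" if "j < nC" for j and w :: "nat \<Rightarrow> 'b::comm_monoid_add"
    using assigned[OF that] by auto
  show "feasible nF nC u r y x"
    unfolding feasible_def
  proof (intro conjI allI impI)
    fix i assume i: "i < nF"
    show "0 \<le> y i" using y[OF i] by simp
    have le: "load \<phi> i nC \<le> q i * u i" using q[OF i] by auto
    have sum: "(\<Sum>j<nC. x i j) = int rr * int (load \<phi> i nC)"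
    proof -
      have "(\<Sum>j<n. x i j) = int rr * int (load \<phi> i n)" if "n \<le> nC" for n
        using that by (induction n) (auto simp: load_Suc x[OF i] algebra_simps)
      then show ?thesis by blast
    qed
    show "(\<Sum>j<nC. x i j) \<le> int (u i) * y i"
    proof -
      have "int (load \<phi> i nC) \<le> int (q i) * int (u i)" using le by (metis of_nat_le_iff of_nat_mult)
      then have "int rr * int (load \<phi> i nC) \<le> int rr * (int (q i) * int (u i))"
        by (intro mult_left_mono) auto
      then show ?thesis unfolding sum y[OF i] by (simp add: ac_simps)
    qed
    fix j assume j: "j < nC"
    show "0 \<le> x i j" using x[OF i j] by simp
    show "x i j \<le> y i"
    proof (cases "\<phi> j = Some i")
      case True
      then have "load \<phi> i nC > 0" using j by (auto simp: load_def card_gt_0_iff)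
      then have "q i > 0" using le by (cases "q i") auto
      then have "int rr * 1 \<le> int rr * int (q i)" by (intro mult_left_mono) auto
      then show ?thesis using True x[OF i j] y[OF i] by simp
    qed (simp add: x[OF i j] y[OF i])
  next
    fix j assume j: "j < nC"
    have "(\<Sum>i<nF. x i j) = (\<Sum>i<nF. if \<phi> j = Some i then int rr else 0)"
      using x j by simp
    then show "int (r j) \<le> (\<Sum>i<nF. x i j)" using one_site[OF j, of "\<lambda>i. int rr"] r[OF j] by simp
  qed
  assume feas: "feasible nF nC u r y' x'"
  have copies: "f i * real (q i) \<le> (f i - g i) + h i * real (load \<phi> i nC)" if i: "i < nF" for i
  proof (cases "load \<phi> i nC = 0")
    case True
    then have "q i = 0" using q[OF i] by auto
    then show ?thesis using gf[OF i] True by simp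
  next
    case False
    then obtain j where "j < nC" "\<phi> j = Some i" by (auto simp: load_def)
    then have g0: "g i = 0" using opened by blast
    have "q i * u i \<le> load \<phi> i nC + u i" using q[OF i] by auto
    then have "real (q i) * real (u i) \<le> real (load \<phi> i nC) + real (u i)"
      by (metis of_nat_add of_nat_le_iff of_nat_mult)
    then have "real (q i) \<le> (real (load \<phi> i nC) + real (u i)) / real (u i)"
      using u_pos[OF i] by (simp add: pos_le_divide_eq)
    then have "f i * real (q i) \<le> f i * ((real (load \<phi> i nC) + real (u i)) / real (u i))"
      using f_nonneg[OF i] by (rule mult_left_mono)
    then show ?thesis using u_pos[OF i] g0 by (simp add: h_def field_simps)
  qed
  have "total_cost nF nC f c y x =
      real rr * ((\<Sum>i<nF. f i * real (q i)) + (\<Sum>i<nF. \<Sum>j<nC. if \<phi> j = Some i then c i j else 0))"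
    unfolding total_cost_def distrib_left sum_distrib_left using x y
    by (intro arg_cong2[where f = "(+)"] sum.cong refl) auto
  also have "\<dots> \<le> real rr * ((\<Sum>i<nF. (f i - g i) + h i * real (load \<phi> i nC)) +
      (\<Sum>i<nF. \<Sum>j<nC. if \<phi> j = Some i then c i j else 0))"
    using copies by (intro mult_left_mono add_right_mono sum_mono) auto
  also have "\<dots> = real rr * ((\<Sum>i<nF. f i - g i) + (\<Sum>i<nF. \<Sum>j<nC. if \<phi> j = Some i then d i j else 0))"
  proof -
    have "h i * real (load \<phi> i nC) + (\<Sum>j<nC. if \<phi> j = Some i then c i j else 0) =
        (\<Sum>j<nC. if \<phi> j = Some i then d i j else 0)" for i
      unfolding load_eq_sum sum_distrib_left sum.distrib[symmetric]
      by (intro sum.cong) (auto simp: d_def)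
    then show ?thesis by (simp add: sum.distrib[symmetric] add.assoc)
  qed
  also have "(\<Sum>i<nF. \<Sum>j<nC. if \<phi> j = Some i then d i j else 0) = (\<Sum>j<nC. conn_cost \<phi> j)"
  proof -
    have "(\<Sum>i<nF. if \<phi> j = Some i then d i j else 0) = conn_cost \<phi> j" if "j < nC" for j
      using one_site[OF that, of "\<lambda>i. d i j"] assigned[OF that] by (auto simp: conn_cost_def)
    then show ?thesis by (subst sum.swap) simp
  qed
  also have "real rr * ((\<Sum>i<nF. f i - g i) + (\<Sum>j<nC. conn_cost \<phi> j)) \<le> real rr * (\<Sum>j<nC. \<alpha> j)"
    using cost by (intro mult_left_mono) auto
  also have "\<dots> \<le> 2 * total_cost nF nC f c y' x'"
    using price_bound[OF pr all, unfolded lessThan_iff] by (intro price_sum_le[OF _ feas r]) auto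
  finally show "total_cost nF nC f c y x \<le> 2 * total_cost nF nC f c y' x'" .
qed

end

section \<open>The program\<close>

lemma eff_simps [simp]:
  "eff (IConst a k) (I, R) = (I(a := k), R)"
  "eff (IAdd a b c) (I, R) = (I(a := I b + I c), R)"
  "eff (ISub a b c) (I, R) = (I(a := I b - I c), R)"
  "eff (ILoad a b) (I, R) = (I(a := I (I b)), R)"
  "eff (IStore a b) (I, R) = (I(I a := I b), R)"
  "eff (IToR a b) (I, R) = (I, R(a := of_int (I b)))"
  "eff (RLoad a b) (I, R) = (I, R(a := R (I b)))"
  "eff (RStore a b) (I, R) = (I, R(I a := R b))"
  "eff (RAdd a b c) (I, R) = (I, R(a := R b + R c))"
  "eff (RSub a b c) (I, R) = (I, R(a := R b - R c))"
  "eff (RMul a b c) (I, R) = (I, R(a := R b * R c))"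
  "eff (RDiv a b c) (I, R) = (I, R(a := R b / R c))"
  by (simp_all add: eff_def)

lemma triple_exI:
  assumes "\<And>x. triple (P x) c Q T"
  shows "triple (\<lambda>s. \<exists>x. P x s) c Q T"
  using assms unfolding triple_def by blast

definition skip :: com where "skip = Bas []"

text \<open>The input stores row \<open>i\<close> of the costs from this address on, and the output
  block for \<open>x\<close> is its mirror image at \<open>-1 - (rowptr nF nC i + j)\<close>, so one
  pointer serves for both.\<close>

definition rowptr :: "nat \<Rightarrow> nat \<Rightarrow> nat \<Rightarrow> int" where
  "rowptr nF nC i = int nF + int i * int nC"

lemma rowptr_nonneg: "0 \<le> rowptr nF nC i"
  by (simp add: rowptr_def)

lemma rowptr_0: "rowptr nF nC 0 = int nF"
  by (simp add: rowptr_def)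

lemma rowptr_Suc: "rowptr nF nC (Suc i) = rowptr nF nC i + int nC"
  by (simp add: rowptr_def algebra_simps)

lemma rowptr_mono: "i \<le> i' \<Longrightarrow> rowptr nF nC i \<le> rowptr nF nC i'"
  by (simp add: rowptr_def mult_right_mono)

lemma rowptr_less: "i < i' \<Longrightarrow> rowptr nF nC i + int nC \<le> rowptr nF nC i'"
  using rowptr_mono[of "Suc i" i'] by (simp add: rowptr_Suc)

lemma rowptr_pos: "i < nF \<Longrightarrow> 0 < rowptr nF nC i"
  by (simp add: rowptr_def add_pos_nonneg)

lemma rowptr_eq_iff:
  assumes "j < nC" "j' < nC"
  shows "rowptr nF nC i + int j = rowptr nF nC i' + int j' \<longleftrightarrow> i = i' \<and> j = j'"
  using assms rowptr_less[of i i' nF nC] rowptr_less[of i' i nF nC]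
  by (cases i i' rule: linorder_cases) auto

text \<open>Integer registers: 0 \<open>nF\<close>; 1 \<open>nC\<close>; 2 the requirement; 3 one; 4 \<open>40 + nC\<close>; 5 \<open>rowptr nF\<close>;
  6, 7 current site \<open>i\<close> and \<open>rowptr i\<close>; 8, 9 client or rank; 10, 11, 12, 20 scratch; 13 to 16 the best
  star (found, \<open>rowptr\<close> of its site, last rank, site); 17 iteration; 18 zero; 19 minus twenty; 21 minus one.

  Integer arrays: \<open>k\<close>-th client around site \<open>i\<close> at \<open>40 + nC + rowptr i + k\<close>; assignment of client \<open>j\<close>
  at \<open>40 + nC + rowptr nF + j\<close>, stored as the (positive) \<open>rowptr\<close> of its site, or 0.

  Real memory: remaining opening cost at \<open>i\<close>; surcharged cost at \<open>rowptr i + j\<close>; present cost of client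
  \<open>j\<close> at \<open>rowptr nF + j\<close>; capacity at \<open>-20 - i\<close>; registers at \<open>-1\<close> to \<open>-7\<close>.\<close>

definition saving_body :: com where
  "saving_body = Bas [IAdd 10 5 8, IAdd 11 4 10, ILoad 12 11] ;;
     IfI 12 18 skip
       (Bas [RLoad (-2) 10, IAdd 11 7 8, RLoad (-3) 11] ;;
        IfR (-2) (-3) skip (Bas [RSub (-2) (-2) (-3), RSub (-1) (-1) (-2)])) ;;
     Bas [IAdd 8 8 3]"

text \<open>There is no move instruction; a cell is copied by adding a zero register,
  \<open>18\<close> for integers and \<open>-7\<close> for reals.\<close>

definition set_best :: com where
  "set_best = Bas [IConst 13 1, RAdd (-6) (-2) (-7), IAdd 14 7 18, IAdd 15 8 18, IAdd 16 6 18]"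

text \<open>Prolonging a prefix by an unconnected client costs one addition to the numerator in
  \<open>-1\<close> and one to the size in \<open>-4\<close>, so all stars of a site are compared in
  one linear pass.\<close>

definition scan_body :: com where
  "scan_body = Bas [IAdd 11 4 7, IAdd 11 11 8, ILoad 9 11, IAdd 10 5 9, IAdd 11 4 10, ILoad 12 11] ;;
     IfI 12 18
       (Bas [IAdd 11 7 9, RLoad (-3) 11, RAdd (-1) (-1) (-3), RAdd (-4) (-4) (-5), RDiv (-2) (-1) (-4)] ;;
        IfI 13 18 set_best (IfR (-6) (-2) skip set_best))
       skip ;;
     Bas [IAdd 8 8 3]"

definition site_body :: com where
  "site_body = Bas [RLoad (-1) 6, IConst 8 0] ;; While 8 1 saving_body ;;
     Bas [IConst 8 0, IToR (-4) 18, IToR (-5) 3, IToR (-7) 18] ;; While 8 1 scan_body ;;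
     Bas [IAdd 7 7 1, IAdd 6 6 3]"

definition set_site :: com where
  "set_site = Bas [IStore 11 14, RStore 10 (-3)]"

text \<open>Clients are visited in the order around the chosen site, where membership in the star is
  a comparison of ranks. A connected client switches only if that is strictly cheaper.\<close>

definition assign_body :: com where
  "assign_body = Bas [IAdd 11 4 14, IAdd 11 11 8, ILoad 9 11, IAdd 10 5 9, IAdd 11 4 10, ILoad 12 11,
       IAdd 20 14 9, RLoad (-3) 20] ;;
     IfI 12 18 (IfI 8 15 set_site skip) (Bas [RLoad (-2) 10] ;; IfR (-2) (-3) skip set_site) ;;
     Bas [IAdd 8 8 3]"

definition search :: com where
  "search = Bas [IConst 13 0, IConst 6 0, IAdd 7 0 18] ;; While 6 0 site_body"

definition iterate :: com where
  "iterate = (search ;;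
     IfI 13 18 skip (Bas [IToR (-7) 18, RStore 16 (-7), IConst 8 0] ;; While 8 1 assign_body)) ;;
     Bas [IAdd 17 17 3]"

definition greedy :: com where
  "greedy = Bas [IConst 17 0] ;; While 17 1 iterate"

text \<open>Equality of cells \<open>7\<close> and \<open>12\<close> is tested by two comparisons.
  Register \<open>-2\<close> holds the free places of the last copy, cell \<open>9\<close> the
  requirement times the number of copies.\<close>

definition emit_body :: com where
  "emit_body = Bas [IAdd 11 5 8, IAdd 11 4 11, ILoad 12 11] ;;
     IfI 12 7
       (IfI 7 12
         (IfR (-2) (-7) (Bas [IAdd 9 9 2, RAdd (-2) (-1) (-7)]) skip ;;
          Bas [RSub (-2) (-2) (-5), ISub 11 21 7, ISub 11 11 8, IStore 11 2])
         skip)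
       skip ;;
     Bas [IAdd 8 8 3]"

definition emit_row :: com where
  "emit_row = Bas [ISub 10 19 6, RLoad (-1) 10, IToR (-2) 18, IConst 9 0, IConst 8 0] ;;
     While 8 1 emit_body ;;
     Bas [ISub 11 21 6, IStore 11 9, IAdd 7 7 1, IAdd 6 6 3]"

definition emit :: com where
  "emit = Bas [IConst 6 0, IAdd 7 0 18, IToR (-7) 18, IToR (-5) 3, IConst 21 (-1)] ;; While 6 0 emit_row"

definition charge_body :: com where
  "charge_body = Bas [IAdd 11 7 8, RLoad (-2) 11, RAdd (-2) (-2) (-1), RStore 11 (-2), IAdd 8 8 3]"

text \<open>The position of client \<open>8\<close> is found by counting the clients that precede
  it. This is quadratic per site, which the cubic bound affords; ties are broken by index, so
  positions are distinct.\<close>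

definition count_body :: com where
  "count_body = Bas [IAdd 11 7 9, RLoad (-3) 11] ;;
     IfR (-2) (-3) (IfR (-3) (-2) (IfI 8 9 skip (Bas [IAdd 10 10 3])) skip) (Bas [IAdd 10 10 3]) ;;
     Bas [IAdd 9 9 3]"

definition place_body :: com where
  "place_body = Bas [IAdd 11 7 8, RLoad (-2) 11, IConst 9 0, IConst 10 0] ;; While 9 1 count_body ;;
     Bas [IAdd 11 4 7, IAdd 11 11 10, IStore 11 8, IAdd 8 8 3]"

definition prep_row_body :: com where
  "prep_row_body = Bas [ISub 10 19 6, RLoad (-1) 10, RLoad (-2) 6, RDiv (-1) (-2) (-1), IConst 8 0] ;;
     While 8 1 charge_body ;; Bas [IConst 8 0] ;; While 8 1 place_body ;; Bas [IAdd 7 7 1, IAdd 6 6 3]"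

definition prepare :: com where
  "prepare = While 6 0 prep_row_body ;; Bas [IAdd 5 7 18, IConst 17 0]"

text \<open>Capacities are moved to the real memory, where they are used as divisors and as counts
  of free places; their input cells may be overwritten by registers later.\<close>

definition load_body :: com where
  "load_body = Bas [ILoad (-4) (-3), IToR (-1) (-4), RStore (-5) (-1), IAdd (-3) (-3) (-2),
     ISub (-5) (-5) (-2), IAdd (-1) (-1) (-2)]"

text \<open>At the start every nonnegative cell may hold input, so the first loop runs on negative registers,
  which are output cells and are cleared afterwards.\<close>

definition load_caps :: com where
  "load_caps = Bas [IConst (-2) 1, IConst (-1) 0, IConst (-3) 2, IAdd (-3) (-3) 1, IConst (-5) (-20)] ;;
     While (-1) 0 load_body ;;
     Bas [IConst (-1) 0, IConst (-2) 0, IConst (-3) 0, IConst (-4) 0, IConst (-5) 0, IConst 3 1,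
       IConst 4 40, IAdd 4 4 1, IConst 18 0, IConst 19 (-20), IConst 6 0, IAdd 7 0 18]"

definition solve :: com where
  "solve = load_caps ;; prepare ;; greedy ;; emit"

section \<open>Correctness of the program\<close>

context metric_cuftra
begin

section \<open>Memory contents and scratch cells\<close>

abbreviation rp :: "nat \<Rightarrow> int" where
  "rp \<equiv> rowptr nF nC"

text \<open>Arrays start at \<open>40 + nC + rp 0\<close>, beyond the registers and the integer
  input. Negative integer cells form the output and must still be 0, because only the nonzero
  entries of \<open>x\<close> get written.\<close>

definition encodes :: "nat \<Rightarrow> nat \<Rightarrow> (nat \<Rightarrow> nat \<Rightarrow> nat) \<Rightarrow> (nat \<Rightarrow> nat option) \<Rightarrow> (nat \<Rightarrow> real) \<Rightarrow> memory \<Rightarrow> bool" where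
  "encodes rr it p \<phi> g s \<longleftrightarrow> (case s of (I, R) \<Rightarrow>
     (I 0 = int nF \<and> I 1 = int nC \<and> I 2 = int rr \<and> I 3 = 1 \<and> I 4 = 40 + int nC \<and> I 5 = rp nF \<and>
     I 17 = int it \<and> I 18 = 0 \<and> I 19 = -20) \<and> (\<forall>a<0. I a = 0) \<and>
     (\<forall>i<nF. \<forall>k<nC. I (40 + int nC + rp i + int k) = int (p i k)) \<and>
     (\<forall>j<nC. I (40 + int nC + (rp nF + int j)) = (case \<phi> j of None \<Rightarrow> 0 | Some i \<Rightarrow> rp i)) \<and>
     (\<forall>i<nF. R (int i) = g i) \<and>
     (\<forall>i<nF. \<forall>j<nC. R (rp i + int j) = d i j) \<and>
     (\<forall>i<nF. R (-20 - int i) = real (u i)) \<and>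
     (\<forall>j<nC. \<forall>i. \<phi> j = Some i \<longrightarrow> R (rp nF + int j) = d i j))"

lemma encodesD:
  assumes "encodes rr it p \<phi> g (I, R)"
  shows "I 0 = int nF" "I 1 = int nC" "I 2 = int rr" "I 3 = 1" "I 4 = 40 + int nC" "I 5 = rp nF"
    "I 17 = int it" "I 18 = 0" "I 19 = -20" "a < 0 \<Longrightarrow> I a = 0"
    "i < nF \<Longrightarrow> k < nC \<Longrightarrow> I (40 + int nC + rp i + int k) = int (p i k)"
    "j < nC \<Longrightarrow> I (40 + int nC + (rp nF + int j)) = (case \<phi> j of None \<Rightarrow> 0 | Some i \<Rightarrow> rp i)"
    "i < nF \<Longrightarrow> R (int i) = g i"
    "i < nF \<Longrightarrow> j < nC \<Longrightarrow> R (rp i + int j) = d i j"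
    "i < nF \<Longrightarrow> R (-20 - int i) = real (u i)"
    "j < nC \<Longrightarrow> \<phi> j = Some i \<Longrightarrow> R (rp nF + int j) = d i j"
  using assms by (simp_all add: encodes_def)

text \<open>Frame property: integer cells 6 to 16, 20 and 21 and real cells -19 to -1 are scratch.
  The two rules derived from it let rewriting drop such writes during symbolic execution.\<close>

lemma encodes_agree:
  assumes st: "encodes rr it p \<phi> g (I, R)"
    and I: "\<And>a. a < 6 \<or> a = 17 \<or> a = 18 \<or> a = 19 \<or> 40 \<le> a \<Longrightarrow> I' a = I a"
    and R: "\<And>a. 0 \<le> a \<or> a \<le> -20 \<Longrightarrow> R' a = R a"
  shows "encodes rr it p \<phi> g (I', R')"
proof -
  have "I' (40 + int nC + rp i + int k) = I (40 + int nC + rp i + int k)"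
    "I' (40 + int nC + (rp nF + int k)) = I (40 + int nC + (rp nF + int k))" for i k
    using rowptr_nonneg[of nF nC i] rowptr_nonneg[of nF nC nF] by (intro I; linarith)+
  moreover have "R' (int i) = R (int i)" "R' (rp i + int j) = R (rp i + int j)"
    "R' (-20 - int i) = R (-20 - int i)" for i j
    using rowptr_nonneg[of nF nC i] by (intro R; linarith)+
  ultimately show ?thesis
    using st I[of 0] I[of 1] I[of 2] I[of 3] I[of 4] I[of 5] I[of 17] I[of 18] I[of 19]
    by (simp add: encodes_def I)
qed

lemma encodes_scratchI [simp]:
  assumes "6 \<le> a \<and> a \<le> 16 \<or> a = 20 \<or> a = 21"
  shows "encodes rr it p \<phi> g (I(a := v), R) = encodes rr it p \<phi> g (I, R)"
  using assms by (intro iffI; elim encodes_agree) (simp_all split: if_splits, linarith+)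

lemma encodes_scratchR [simp]:
  assumes "-19 \<le> a \<and> a < 0"
  shows "encodes rr it p \<phi> g (I, R(a := v)) = encodes rr it p \<phi> g (I, R)"
  using assms by (intro iffI; elim encodes_agree) (simp_all, linarith+)

section \<open>Search for the star of least ratio\<close>

definition cand :: "(nat \<Rightarrow> nat \<Rightarrow> nat) \<Rightarrow> (nat \<Rightarrow> nat option) \<Rightarrow> nat \<Rightarrow> nat \<Rightarrow> bool" where
  "cand p \<phi> i k \<longleftrightarrow> i < nF \<and> k < nC \<and> p i k \<in> unconn \<phi>"

definition ratio :: "(nat \<Rightarrow> nat \<Rightarrow> nat) \<Rightarrow> (nat \<Rightarrow> nat option) \<Rightarrow> (nat \<Rightarrow> real) \<Rightarrow> nat \<Rightarrow> nat \<Rightarrow> real" where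
  "ratio p \<phi> g i k = (gap \<phi> g i + (\<Sum>j\<in>star p \<phi> i (Suc k). d i j)) / real (card (star p \<phi> i (Suc k)))"

definition before :: "nat \<Rightarrow> nat \<Rightarrow> (nat \<times> nat) set" where
  "before i k = {(i', k'). i' < i \<or> i' = i \<and> k' < k}"

definition best :: "(nat \<Rightarrow> nat \<Rightarrow> nat) \<Rightarrow> (nat \<Rightarrow> nat option) \<Rightarrow> (nat \<Rightarrow> real) \<Rightarrow>
    (nat \<times> nat) set \<Rightarrow> memory \<Rightarrow> bool" where
  "best p \<phi> g Z s \<longleftrightarrow> (case s of (I, R) \<Rightarrow>
     I 13 = 0 \<and> (\<forall>i k. cand p \<phi> i k \<longrightarrow> (i, k) \<notin> Z) \<or>
     I 13 = 1 \<and> (\<exists>bi bk. cand p \<phi> bi bk \<and> (bi, bk) \<in> Z \<and> I 14 = rp bi \<and> I 15 = int bk \<and>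
       I 16 = int bi \<and> R (-6) = ratio p \<phi> g bi bk \<and>
       (\<forall>i k. cand p \<phi> i k \<longrightarrow> (i, k) \<in> Z \<longrightarrow> R (-6) \<le> ratio p \<phi> g i k)))"

lemma best_scratchI [simp]:
  "a < 13 \<or> a > 16 \<Longrightarrow> best p \<phi> g Z (I(a := v), R) = best p \<phi> g Z (I, R)"
  by (auto simp: best_def)

lemma best_scratchR [simp]:
  "a \<noteq> -6 \<Longrightarrow> best p \<phi> g Z (I, R(a := v)) = best p \<phi> g Z (I, R)"
  by (auto simp: best_def)

lemma before_Suc: "before i (Suc k) = insert (i, k) (before i k)"
  by (auto simp: before_def)

lemma best_skip: "best p \<phi> g (before i k) s \<Longrightarrow> \<not> cand p \<phi> i k \<Longrightarrow> best p \<phi> g (before i (Suc k)) s"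
  by (auto simp: best_def before_Suc)

lemma best_keep:
  "best p \<phi> g (before i k) (I, R) \<Longrightarrow> I 13 \<noteq> 0 \<Longrightarrow> R (-6) \<le> ratio p \<phi> g i k \<Longrightarrow>
    best p \<phi> g (before i (Suc k)) (I, R)"
  by (auto simp: best_def before_Suc)

lemma best_set:
  assumes "best p \<phi> g (before i k) (I, R)" "I 13 = 0 \<or> ratio p \<phi> g i k \<le> R (-6)" "cand p \<phi> i k"
    "I' 13 = 1" "I' 14 = rp i" "I' 15 = int k" "I' 16 = int i" "R' (-6) = ratio p \<phi> g i k"
  shows "best p \<phi> g (before i (Suc k)) (I', R')"
  unfolding best_def prod.case
proof (rule disjI2, rule conjI, fact, rule exI[of _ i], rule exI[of _ k], intro conjI)
  show "\<forall>i' k'. cand p \<phi> i' k' \<longrightarrow> (i', k') \<in> before i (Suc k) \<longrightarrow> R' (- 6) \<le> ratio p \<phi> g i' k'"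
  proof (intro allI impI)
    fix i' k' assume c: "cand p \<phi> i' k'" and "(i', k') \<in> before i (Suc k)"
    then consider "(i', k') \<in> before i k" | "i' = i" "k' = k" by (auto simp: before_Suc)
    then show "R' (-6) \<le> ratio p \<phi> g i' k'"
    proof cases
      case 1
      then have "I 13 \<noteq> 0 \<and> R (-6) \<le> ratio p \<phi> g i' k'" using assms(1) c by (auto simp: best_def)
      then show ?thesis using assms(2,8) by auto
    qed (use assms(8) in simp)
  qed
qed (use assms in \<open>auto simp: before_Suc\<close>)

text \<open>Candidates have rank below \<open>nC\<close>, so the end of one row and the start of the
  next mean the same.\<close>

lemma best_row:
  assumes "best p \<phi> g (before i nC) s"
  shows "best p \<phi> g (before (Suc i) 0) s"
proof -
  have "cand p \<phi> i' k' \<Longrightarrow> (i', k') \<in> before (Suc i) 0 \<longleftrightarrow> (i', k') \<in> before i nC" for i' k'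
    by (auto simp: before_def cand_def)
  then show ?thesis using assms by (simp add: best_def cong: conj_cong imp_cong)
qed

lemma best_found:
  assumes "best p \<phi> g (before nF 0) (I, R)" "I 13 \<noteq> 0"
  obtains bi bk where "cand p \<phi> bi bk" "I 14 = rp bi" "I 15 = int bk" "I 16 = int bi"
    "\<And>i k. cand p \<phi> i k \<Longrightarrow> ratio p \<phi> g bi bk \<le> ratio p \<phi> g i k"
proof -
  obtain bi bk where b: "cand p \<phi> bi bk" "I 14 = rp bi" "I 15 = int bk" "I 16 = int bi"
    "R (-6) = ratio p \<phi> g bi bk"
    "\<forall>i k. cand p \<phi> i k \<longrightarrow> (i, k) \<in> before nF 0 \<longrightarrow> R (-6) \<le> ratio p \<phi> g i k"
    using assms unfolding best_def by auto
  moreover have "(i, k) \<in> before nF 0" if "cand p \<phi> i k" for i k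
    using that by (simp add: cand_def before_def)
  ultimately show thesis using that by metis
qed

lemma best_none:
  assumes p: "nearest_order p" and b: "best p \<phi> g (before nF 0) (I, R)" and I: "I 13 = 0"
  shows "unconn \<phi> = {}"
proof (rule ccontr)
  assume "unconn \<phi> \<noteq> {}"
  then obtain j where j: "j \<in> unconn \<phi>" by blast
  then have "j < nC" by (simp add: unconn_def)
  with nearest_order_surj[OF p nF_pos this] obtain k where "k < nC" "p 0 k = j" by metis
  then have "cand p \<phi> 0 k" "(0, k) \<in> before nF 0"
    using j nF_pos by (auto simp: cand_def before_def)
  then show False using b I by (auto simp: best_def)
qed

definition valid :: "(nat \<Rightarrow> nat option) \<Rightarrow> bool" where
  "valid \<phi> \<longleftrightarrow> (\<forall>j<nC. \<forall>i. \<phi> j = Some i \<longrightarrow> i < nF)"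

lemma validD: "valid \<phi> \<Longrightarrow> j < nC \<Longrightarrow> \<phi> j = Some i \<Longrightarrow> i < nF"
  by (simp add: valid_def)

definition saving_inv where
  "saving_inv rr it p \<phi> g i k s \<longleftrightarrow> (case s of (I, R) \<Rightarrow> encodes rr it p \<phi> g (I, R) \<and> best p \<phi> g (before i 0) (I, R) \<and>
     I 6 = int i \<and> I 7 = rp i \<and> I 8 = int k \<and> R (-1) = g i - (\<Sum>j<k. saving \<phi> i j))"

lemma saving_body:
  assumes k: "k < nC" and i: "i < nF" and \<phi>: "valid \<phi>"
  shows "triple (saving_inv rr it p \<phi> g i k) saving_body (saving_inv rr it p \<phi> g i (Suc k)) 20"
proof (rule triple_loop_free)
  fix I R assume *: "saving_inv rr it p \<phi> g i k (I, R)"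
  then have st: "encodes rr it p \<phi> g (I, R)" by (simp add: saving_inv_def)
  note [simp] = encodesD[OF st] k i
  have "40 + int nC + (rp nF + int k) \<noteq> 10" "40 + int nC + (rp nF + int k) \<noteq> 11" "rp i + int k \<noteq> -2"
    using rowptr_nonneg[of nF nC nF] rowptr_nonneg[of nF nC i] by linarith+
  \<comment> \<open>The saving as computed: row pointers are positive, so the assignment cell is at
    most 0 exactly for unconnected clients.\<close>
  moreover have "saving \<phi> i k = (if (case \<phi> k of None \<Rightarrow> 0 | Some x \<Rightarrow> rp x) \<le> 0 \<or> R (rp nF + int k) \<le> d i k
      then 0 else R (rp nF + int k) - d i k)"
    using rowptr_pos[OF validD[OF \<phi> k], of _ nC]
    by (auto simp: saving_def not_le split: option.split)
  ultimately show "saving_inv rr it p \<phi> g i (Suc k) (den saving_body (I, R))"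
    using * by (simp add: saving_body_def skip_def saving_inv_def)
qed (simp_all add: saving_body_def skip_def)

definition scan_inv where
  "scan_inv rr it p \<phi> g i k s \<longleftrightarrow> (case s of (I, R) \<Rightarrow> encodes rr it p \<phi> g (I, R) \<and> best p \<phi> g (before i k) (I, R) \<and>
     I 6 = int i \<and> I 7 = rp i \<and> I 8 = int k \<and> R (-5) = 1 \<and> R (-7) = 0 \<and>
     R (-4) = real (card (star p \<phi> i k)) \<and> R (-1) = gap \<phi> g i + (\<Sum>j\<in>star p \<phi> i k. d i j))"

lemma scan_body:
  assumes p: "nearest_order p" and k: "k < nC" and i: "i < nF"
    and \<phi>: "valid \<phi>"
  shows "triple (scan_inv rr it p \<phi> g i k) scan_body (scan_inv rr it p \<phi> g i (Suc k)) 30"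
proof (rule triple_loop_free)
  fix I R assume *: "scan_inv rr it p \<phi> g i k (I, R)"
  then have st: "encodes rr it p \<phi> g (I, R)" and b: "best p \<phi> g (before i k) (I, R)"
    by (simp_all add: scan_inv_def)
  define j where "j = p i k"
  have j: "j < nC" using nearest_order_less[OF p i k] by (simp add: j_def)
  note [simp] = encodesD[OF st] k i j j_def[symmetric]
  have addr: "40 + int nC + (rp nF + int j) \<noteq> 9" "40 + int nC + (rp nF + int j) \<noteq> 10"
      "40 + int nC + (rp nF + int j) \<noteq> 11" "40 + int nC + rp i + int k \<noteq> 11"
      "rp i + int j \<noteq> -3"
    using rowptr_nonneg[of nF nC nF] rowptr_nonneg[of nF nC i] by linarith+
  have un: "(case \<phi> j of None \<Rightarrow> 0 | Some x \<Rightarrow> rp x) \<le> 0 \<longleftrightarrow> j \<in> unconn \<phi>"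
    using rowptr_pos[OF validD[OF \<phi> j], of _ nC] j by (auto simp: unconn_def not_le split: option.split)
  have notin: "j \<notin> star p \<phi> i k" using in_star_iff[OF p i k less_imp_le[OF k]] by simp
  show "scan_inv rr it p \<phi> g i (Suc k) (den scan_body (I, R))"
  proof (cases "j \<in> unconn \<phi>")
    case False
    then have "\<not> cand p \<phi> i k" by (simp add: cand_def)
    then show ?thesis
      using * addr un False best_skip[OF b]
      by (simp add: scan_body_def skip_def scan_inv_def star_Suc)
  next
    case True
    then have c: "cand p \<phi> i k" by (simp add: cand_def)
    have rt: "ratio p \<phi> g i k =
        (gap \<phi> g i + sum (d i) (star p \<phi> i k) + d i j) / (real (card (star p \<phi> i k)) + 1)"
      using True notin by (simp add: ratio_def star_Suc algebra_simps)
    have 13: "I 13 = 0 \<or> I 13 = 1" using b by (auto simp: best_def)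
    show ?thesis
      using * addr un True notin 13
      apply (simp add: scan_body_def skip_def set_best_def scan_inv_def star_Suc rt)
      by (intro conjI impI; (rule best_keep[OF b] | rule best_set[OF b _ c]); auto simp: rt)
  qed
qed (simp_all add: scan_body_def skip_def set_best_def)


definition site_inv where
  "site_inv rr it p \<phi> g i s \<longleftrightarrow> (case s of (I, R) \<Rightarrow> encodes rr it p \<phi> g (I, R) \<and> best p \<phi> g (before i 0) (I, R) \<and>
     I 6 = int i \<and> I 7 = rp i)"

lemma site_body:
  assumes p: "nearest_order p" and i: "i < nF" and \<phi>: "valid \<phi>"
  shows "triple (site_inv rr it p \<phi> g i) site_body (site_inv rr it p \<phi> g (Suc i)) (60 * nC + 20)"
proof -
  have 1: "triple (site_inv rr it p \<phi> g i) (Bas [RLoad (-1) 6, IConst 8 0]) (saving_inv rr it p \<phi> g i 0) 2"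
  proof (rule triple_loop_free)
    fix I R assume *: "site_inv rr it p \<phi> g i (I, R)"
    then have st: "encodes rr it p \<phi> g (I, R)" by (simp add: site_inv_def)
    show "saving_inv rr it p \<phi> g i 0 (den (Bas [RLoad (- 1) 6, IConst 8 0]) (I, R))"
      using * i by (simp add: site_inv_def saving_inv_def encodesD[OF st])
  qed simp_all
  have 2: "triple (saving_inv rr it p \<phi> g i 0) (While 8 1 saving_body) (saving_inv rr it p \<phi> g i nC) (nC * (20 + 2) + 1)"
    by (rule triple_While[where Inv = "saving_inv rr it p \<phi> g i", OF saving_body[OF _ i \<phi>]]) (auto simp: saving_inv_def encodesD)
  have 3: "triple (saving_inv rr it p \<phi> g i nC) (Bas [IConst 8 0, IToR (-4) 18, IToR (-5) 3, IToR (-7) 18])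
      (scan_inv rr it p \<phi> g i 0) 4"
  proof (rule triple_loop_free)
    fix I R assume *: "saving_inv rr it p \<phi> g i nC (I, R)"
    then have st: "encodes rr it p \<phi> g (I, R)" by (simp add: saving_inv_def)
    show "scan_inv rr it p \<phi> g i 0 (den (Bas [IConst 8 0, IToR (-4) 18, IToR (-5) 3, IToR (-7) 18]) (I, R))"
      using * i by (simp add: saving_inv_def scan_inv_def encodesD[OF st] gap_def)
  qed simp_all
  have 4: "triple (scan_inv rr it p \<phi> g i 0) (While 8 1 scan_body) (scan_inv rr it p \<phi> g i nC) (nC * (30 + 2) + 1)"
    by (rule triple_While[where Inv = "scan_inv rr it p \<phi> g i", OF scan_body[OF p _ i \<phi>]]) (auto simp: scan_inv_def encodesD)
  have 5: "triple (scan_inv rr it p \<phi> g i nC) (Bas [IAdd 7 7 1, IAdd 6 6 3]) (site_inv rr it p \<phi> g (Suc i)) 2"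
  proof (rule triple_loop_free)
    fix I R assume *: "scan_inv rr it p \<phi> g i nC (I, R)"
    then have st: "encodes rr it p \<phi> g (I, R)" by (simp add: scan_inv_def)
    show "site_inv rr it p \<phi> g (Suc i) (den (Bas [IAdd 7 7 1, IAdd 6 6 3]) (I, R))"
      using * i by (simp add: site_inv_def scan_inv_def encodesD[OF st] rowptr_Suc best_row)
  qed simp_all
  show ?thesis
    unfolding site_body_def
    by (rule triple_conseq[OF triple_Seq[OF 1 triple_Seq[OF 2 triple_Seq[OF 3 triple_Seq[OF 4 5]]]]]) auto
qed

section \<open>Reassignment and the greedy loop\<close>

lemma encodes_assign:
  assumes st: "encodes rr it p \<phi> g (I, R)" and j: "j < nC" and i: "i < nF"
  shows "encodes rr it p (\<phi>(j := Some i)) g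
    (I(40 + int nC + (rp nF + int j) := rp i), R(rp nF + int j := d i j))"
proof -
  let ?a = "40 + int nC + (rp nF + int j)"
  have "40 + int nC + rp i' + int k \<noteq> ?a" if "i' < nF" "k < nC" for i' k
    using rowptr_less[OF that(1), of nF nC] that(2) by linarith
  then have "(I(?a := rp i)) (40 + int nC + rp i' + int k) = I (40 + int nC + rp i' + int k)" if "i' < nF" "k < nC" for i' k
    using that by (intro fun_upd_other) blast
  moreover have "(I(?a := rp i)) a = I a" if "a < 40" for a
    using that rowptr_nonneg[of nF nC nF] by (intro fun_upd_other) linarith
  moreover have "(R(rp nF + int j := d i j)) (rp i' + int k) = R (rp i' + int k)" if "i' < nF" "k < nC" for i' k
    using rowptr_less[OF that(1), of nF nC] that(2) by (intro fun_upd_other) linarith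
  moreover have "(R(rp nF + int j := d i j)) a = R a" if "a < int nF" for a
    using that rowptr_mono[of 0 nF nF nC] by (intro fun_upd_other) (simp add: rowptr_0)
  ultimately show ?thesis using st by (simp add: encodes_def del: fun_upd_apply) (simp add: st)
qed

lemma encodes_open:
  assumes st: "encodes rr it p \<phi> g (I, R)" and i: "i < nF"
  shows "encodes rr it p \<phi> (g(i := 0)) (I, R(int i := 0))"
proof -
  have "(R(int i := 0)) (rp i' + int k) = R (rp i' + int k)" for i' k
    using i rowptr_mono[of 0 i' nF nC] by (intro fun_upd_other) (simp add: rowptr_0)
  moreover have "(R(int i := 0)) (-20 - int i') = R (-20 - int i')" for i'
    by (intro fun_upd_other) simp
  ultimately show ?thesis using st by (simp add: encodes_def del: fun_upd_apply) simp
qed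

lemma encodes_cong_assignment: "(\<And>j. j < nC \<Longrightarrow> \<phi> j = \<psi> j) \<Longrightarrow> encodes rr it p \<phi> g s \<longleftrightarrow> encodes rr it p \<psi> g s"
  by (cases s) (simp add: encodes_def)

definition partly :: "(nat \<Rightarrow> nat \<Rightarrow> nat) \<Rightarrow> (nat \<Rightarrow> nat option) \<Rightarrow> nat \<Rightarrow> nat \<Rightarrow> nat \<Rightarrow> nat \<Rightarrow> nat option" where
  "partly p \<phi> bi bk k j = (if j \<in> p bi ` {..<k} then reassign \<phi> bi (star p \<phi> bi (Suc bk)) j else \<phi> j)"

definition assign_inv where
  "assign_inv rr it p \<phi> g bi bk k s \<longleftrightarrow> (case s of (I, R) \<Rightarrow> encodes rr it p (partly p \<phi> bi bk k) g (I, R) \<and>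
     I 8 = int k \<and> I 14 = rp bi \<and> I 15 = int bk)"

lemma assign_body:
  assumes p: "nearest_order p" and k: "k < nC" and bk: "bk < nC" and bi: "bi < nF"
    and \<phi>: "valid \<phi>"
  shows "triple (assign_inv rr it p \<phi> g bi bk k) assign_body (assign_inv rr it p \<phi> g bi bk (Suc k)) 30"
proof (rule triple_loop_free)
  fix I R assume *: "assign_inv rr it p \<phi> g bi bk k (I, R)"
  let ?\<psi> = "partly p \<phi> bi bk k"
  have st: "encodes rr it p ?\<psi> g (I, R)" using * by (simp add: assign_inv_def)
  define j where "j = p bi k"
  have j: "j < nC" using nearest_order_less[OF p bi k] by (simp add: j_def)
  have new: "j \<notin> p bi ` {..<k}"
  proof
    assume "j \<in> p bi ` {..<k}"
    then obtain l where "l < k" "p bi l = p bi k" by (auto simp: j_def)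
    then show False using nearest_order_inj[OF p bi, of l k] k by simp
  qed
  then have old: "?\<psi> j = \<phi> j" by (simp add: partly_def)
  have step: "partly p \<phi> bi bk (Suc k) = ?\<psi>(j := reassign \<phi> bi (star p \<phi> bi (Suc bk)) j)"
    by (rule ext) (simp add: partly_def lessThan_Suc j_def)
  have in_star: "j \<in> star p \<phi> bi (Suc bk) \<longleftrightarrow> \<phi> j = None \<and> k \<le> bk"
    using in_star_iff[OF p bi k, of "Suc bk" \<phi>] bk j by (auto simp: j_def unconn_def)
  note [simp] = encodesD[OF st] k bi j j_def[symmetric] old
  have addr: "40 + int nC + (rp nF + int j) \<noteq> 9" "40 + int nC + (rp nF + int j) \<noteq> 10"
      "40 + int nC + (rp nF + int j) \<noteq> 11" "40 + int nC + rp bi + int k \<noteq> 11"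
      "rp bi + int j \<noteq> -3" "rp nF + int j \<noteq> -2"  "rp nF + int j \<noteq> -3"
      "40 + int nC + (rp nF + int j) \<noteq> 8" "40 + int nC + (rp nF + int j) \<noteq> 14"
      "40 + int nC + (rp nF + int j) \<noteq> 15" "40 + int nC + (rp nF + int j) \<noteq> 3"
      "40 + int nC + (rp nF + int j) \<noteq> 12" "40 + int nC + (rp nF + int j) \<noteq> 20"
    using rowptr_nonneg[of nF nC nF] rowptr_nonneg[of nF nC bi] by linarith+
  show "assign_inv rr it p \<phi> g bi bk (Suc k) (den assign_body (I, R))"
  proof (cases "\<phi> j")
    case None
    then have re: "reassign \<phi> bi (star p \<phi> bi (Suc bk)) j = (if k \<le> bk then Some bi else None)"
      by (simp add: reassign_def in_star)
    have triv: "?\<psi>(j := None) = ?\<psi>" using old None by (auto simp: fun_eq_iff)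
    show ?thesis
      using * addr None encodes_assign[OF _ j bi]
      by (simp add: assign_body_def skip_def set_site_def assign_inv_def step re triv)
  next
    case (Some i')
    then have re: "reassign \<phi> bi (star p \<phi> bi (Suc bk)) j = (if d i' j \<le> d bi j then Some i' else Some bi)"
      by (simp add: reassign_def in_star)
    have triv: "?\<psi>(j := Some i') = ?\<psi>" using old Some by (auto simp: fun_eq_iff)
    have cur: "R (rp nF + int j) = d i' j" using encodesD(16)[OF st j] old Some by simp
    have "\<not> rp i' \<le> 0" using rowptr_pos[OF validD[OF \<phi> j Some], of nC] by simp
    then show ?thesis
      using * addr Some cur encodes_assign[OF _ j bi]
      by (simp add: assign_body_def skip_def set_site_def assign_inv_def step re triv)
  qed
qed (simp_all add: assign_body_def skip_def set_site_def)


lemma search: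
  assumes p: "nearest_order p" and \<phi>: "valid \<phi>"
  shows "triple (encodes rr it p \<phi> g) search (\<lambda>s. encodes rr it p \<phi> g s \<and> best p \<phi> g (before nF 0) s)
    (nF * (60 * nC + 22) + 4)"
proof -
  have 1: "triple (encodes rr it p \<phi> g) (Bas [IConst 13 0, IConst 6 0, IAdd 7 0 18]) (site_inv rr it p \<phi> g 0) 3"
  proof (rule triple_loop_free)
    fix I R assume st: "encodes rr it p \<phi> g (I, R)"
    then show "site_inv rr it p \<phi> g 0 (den (Bas [IConst 13 0, IConst 6 0, IAdd 7 0 18]) (I, R))"
      by (simp add: site_inv_def encodesD[OF st] rowptr_0 best_def before_def)
  qed simp_all
  have 2: "triple (site_inv rr it p \<phi> g 0) (While 6 0 site_body) (site_inv rr it p \<phi> g nF)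
      (nF * (60 * nC + 20 + 2) + 1)"
    by (rule triple_While[where Inv = "site_inv rr it p \<phi> g", OF site_body[OF p _ \<phi>]])
      (auto simp: site_inv_def encodesD)
  show ?thesis
    unfolding search_def
    by (rule triple_conseq[OF triple_Seq[OF 1 2]]) (auto simp: site_inv_def)
qed

text \<open>The greedy time \<open>t\<close> is kept apart from the loop counter \<open>it\<close>:
  the loop always runs \<open>nC\<close> rounds, and rounds after the last connection change
  nothing.\<close>

definition greedy_inv where
  "greedy_inv rr p it s \<longleftrightarrow> (\<exists>\<phi> g t. encodes rr it p \<phi> g s \<and> greedy_state t \<phi> g \<and> card (unconn \<phi>) \<le> nC - it)"

lemma greedy_state_valid: "greedy_state t \<phi> g \<Longrightarrow> valid \<phi>"
  by (simp add: greedy_state_def valid_def)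

text \<open>The scan compares prefixes only; \<open>star_ratio_min\<close> extends minimality to all
  sites and all nonempty sets, as \<open>greedy_state_step\<close> demands.\<close>

lemma greedy_state_best:
  assumes p: "nearest_order p" and st: "greedy_state t \<phi> g" and c: "cand p \<phi> bi bk"
    and min: "\<And>i k. cand p \<phi> i k \<Longrightarrow> ratio p \<phi> g bi bk \<le> ratio p \<phi> g i k"
  shows "greedy_state (Suc t) (reassign \<phi> bi (star p \<phi> bi (Suc bk))) (g(bi := 0))"
proof (rule greedy_state_step[OF st])
  have pos: "0 < real (card (star p \<phi> i (Suc k)))" if "cand p \<phi> i k" for i k
    using that by (auto simp: cand_def card_gt_0_iff star_Suc)
  show "ratio p \<phi> g bi bk * real (card B) \<le> gap \<phi> g i + (\<Sum>j\<in>B. d i j)"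
    if "i < nF" "B \<subseteq> unconn \<phi>" "B \<noteq> {}" for i B
  proof (rule star_ratio_min[OF p that(1) _ that(2,3)])
    fix k assume "k < nC" "p i k \<in> unconn \<phi>"
    then have "cand p \<phi> i k" using that by (simp add: cand_def)
    from min[OF this] pos[OF this]
    show "ratio p \<phi> g bi bk * real (card (star p \<phi> i (Suc k))) \<le> gap \<phi> g i + (\<Sum>j\<in>star p \<phi> i (Suc k). d i j)"
      by (simp add: ratio_def[of p \<phi> g i] pos_le_divide_eq)
  qed
  show "bi < nF" using c by (simp add: cand_def)
  show "star p \<phi> bi (Suc bk) \<subseteq> unconn \<phi>" by (rule star_subset)
  show "ratio p \<phi> g bi bk * real (card (star p \<phi> bi (Suc bk))) =
      gap \<phi> g bi + (\<Sum>j\<in>star p \<phi> bi (Suc bk). d bi j)"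
    unfolding ratio_def times_divide_eq_left
    by (rule nonzero_mult_div_cancel_right) (use pos[OF c] in linarith)
qed

lemma assign_loop:
  assumes p: "nearest_order p" and st: "greedy_state t \<phi> g" and un: "card (unconn \<phi>) \<le> nC - it"
  shows "triple (\<lambda>s. encodes rr it p \<phi> g s \<and> best p \<phi> g (before nF 0) s \<and> fst s 13 \<noteq> 0)
    (Bas [IToR (-7) 18, RStore 16 (-7), IConst 8 0] ;; While 8 1 assign_body)
    (\<lambda>s. \<exists>\<phi> g t. encodes rr it p \<phi> g s \<and> greedy_state t \<phi> g \<and> card (unconn \<phi>) \<le> nC - Suc it) (nC * 32 + 4)"
    (is "triple ?Pre ?c ?Post _")
proof -
  \<comment> \<open>The start state is fixed because the assertions in between mention the site and
    rank stored in it.\<close>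
  have "triple (\<lambda>s. s = s0) ?c ?Post (nC * 32 + 4)" if pre: "?Pre s0" for s0
  proof -
    obtain I R where s0: "s0 = (I, R)" by fastforce
    have sI: "encodes rr it p \<phi> g (I, R)" using pre s0 by simp
    obtain bi bk where c: "cand p \<phi> bi bk" and I: "I 14 = rp bi" "I 15 = int bk" "I 16 = int bi"
      and min: "\<And>i k. cand p \<phi> i k \<Longrightarrow> ratio p \<phi> g bi bk \<le> ratio p \<phi> g i k"
      using best_found[of p \<phi> g I R] pre s0 by auto
    have b: "bi < nF" "bk < nC" "p bi bk \<in> unconn \<phi>" using c by (auto simp: cand_def)
    let ?B = "star p \<phi> bi (Suc bk)"
    let ?g = "g(bi := 0)"
    have 1: "triple (\<lambda>s. s = s0) (Bas [IToR (-7) 18, RStore 16 (-7), IConst 8 0])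
        (assign_inv rr it p \<phi> ?g bi bk 0) 3"
    proof (rule triple_loop_free)
      have "encodes rr it p \<phi> ?g (I, R(-7 := 0, int bi := 0))"
        using encodes_open[OF _ b(1)] sI by simp
      moreover have "partly p \<phi> bi bk 0 = \<phi>" by (simp add: partly_def fun_eq_iff)
      ultimately show "assign_inv rr it p \<phi> ?g bi bk 0
          (den (Bas [IToR (- 7) 18, RStore 16 (- 7), IConst 8 0]) (I', R'))"
        if "(I', R') = s0" for I' R'
        using that s0 I by (simp add: assign_inv_def encodesD[OF sI])
    qed simp_all
    have 2: "triple (assign_inv rr it p \<phi> ?g bi bk 0) (While 8 1 assign_body)
        (assign_inv rr it p \<phi> ?g bi bk nC) (nC * (30 + 2) + 1)"
      by (rule triple_While[where Inv = "assign_inv rr it p \<phi> ?g bi bk",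
            OF assign_body[OF p _ b(2,1) greedy_state_valid[OF st]]])
        (auto simp: assign_inv_def encodesD)
    \<comment> \<open>Progress: at least the last client of the chosen star becomes
      connected.\<close>
    have "card (unconn (reassign \<phi> bi ?B)) < card (unconn \<phi>)"
    proof (rule psubset_card_mono)
      have "p bi bk \<in> ?B" using b by (simp add: star_Suc)
      then show "unconn (reassign \<phi> bi ?B) \<subset> unconn \<phi>" using b(3) by (auto simp: unconn_reassign)
    qed simp
    moreover have "partly p \<phi> bi bk nC j = reassign \<phi> bi ?B j" if "j < nC" for j
      using nearest_order_bij[OF p b(1)] that by (simp add: partly_def bij_betw_def)
    ultimately have "?Post s" if "assign_inv rr it p \<phi> ?g bi bk nC s" for s
      using that greedy_state_best[OF p st c min] un
        encodes_cong_assignment[of "partly p \<phi> bi bk nC" "reassign \<phi> bi ?B"]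
      by (intro exI[of _ "reassign \<phi> bi ?B"] exI[of _ ?g] exI[of _ "Suc t"])
        (auto simp: assign_inv_def split: prod.splits)
    then show ?thesis by (intro triple_conseq[OF triple_Seq[OF 1 2]]) auto
  qed
  then show ?thesis unfolding triple_def by blast
qed

lemma encodes_next: "encodes rr it p \<phi> g (I, R) \<Longrightarrow> encodes rr it' p \<phi> g (I(17 := int it'), R)"
proof -
  assume st: "encodes rr it p \<phi> g (I, R)"
  have "40 + int nC + rp i + int k \<noteq> 17" "40 + int nC + (rp nF + int k) \<noteq> 17" for i k
    using rowptr_nonneg[of nF nC i] rowptr_nonneg[of nF nC nF] by linarith+
  then show ?thesis using st by (simp add: encodes_def)
qed

lemma iterate:
  assumes p: "nearest_order p"
  shows "triple (greedy_inv rr p it) iterate (greedy_inv rr p (Suc it)) (nF * (60 * nC + 22) + nC * 32 + 20)"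
proof -
  let ?Post = "\<lambda>s. \<exists>\<phi> g t. encodes rr it p \<phi> g s \<and> greedy_state t \<phi> g \<and> card (unconn \<phi>) \<le> nC - Suc it"
  have 1: "triple (\<lambda>s. encodes rr it p \<phi> g s \<and> greedy_state t \<phi> g \<and> card (unconn \<phi>) \<le> nC - it)
      (search ;; IfI 13 18 skip (Bas [IToR (-7) 18, RStore 16 (-7), IConst 8 0] ;; While 8 1 assign_body))
      ?Post (nF * (60 * nC + 22) + 4 + (0 + (nC * 32 + 4) + 2))" for \<phi> g t
  proof (cases "greedy_state t \<phi> g \<and> card (unconn \<phi>) \<le> nC - it")
    \<comment> \<open>The facts about \<open>\<phi>\<close> and \<open>g\<close> do not depend on
      the memory and are needed to build the triples; if they fail, the precondition is
      unsatisfiable.\<close>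
    case True
    then have st: "greedy_state t \<phi> g" and un: "card (unconn \<phi>) \<le> nC - it" by auto
    let ?found = "\<lambda>s. encodes rr it p \<phi> g s \<and> best p \<phi> g (before nF 0) s"
    have skip: "triple (\<lambda>s. ?found s \<and> fst s 13 \<le> fst s 18) skip ?Post 0"
      unfolding skip_def
    proof (rule triple_loop_free)
      fix I R assume *: "?found (I, R) \<and> fst (I, R) 13 \<le> fst (I, R) 18"
      then have "I 13 \<le> 0" using encodesD(8) by fastforce
      then have "I 13 = 0" using * by (auto simp: best_def)
      then have "unconn \<phi> = {}" using best_none[OF p] * by blast
      then show "?Post (den (Bas []) (I, R))"
        using * st by (intro exI[of _ \<phi>] exI[of _ g] exI[of _ t]) simp
    qed simp_all
    have "triple (\<lambda>s. ?found s \<and> \<not> fst s 13 \<le> fst s 18)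
        (Bas [IToR (-7) 18, RStore 16 (-7), IConst 8 0] ;; While 8 1 assign_body) ?Post (nC * 32 + 4)"
      by (rule triple_conseq[OF assign_loop[OF p st un]]) (auto simp: encodesD(8))
    from triple_Seq[OF search[OF p greedy_state_valid[OF st]] triple_IfI[OF skip this]]
    show ?thesis by (rule triple_conseq) auto
  qed (auto simp: triple_def)
  have 2: "triple ?Post (Bas [IAdd 17 17 3]) (greedy_inv rr p (Suc it)) 1"
  proof (rule triple_loop_free)
    fix I R assume "?Post (I, R)"
    then obtain \<phi> g t where *: "encodes rr it p \<phi> g (I, R)" "greedy_state t \<phi> g" "card (unconn \<phi>) \<le> nC - Suc it"
      by blast
    have "encodes rr (Suc it) p \<phi> g (den (Bas [IAdd 17 17 3]) (I, R))"
      using encodes_next[OF *(1), of "Suc it"] by (simp add: encodesD[OF *(1)] add.commute)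
    then show "greedy_inv rr p (Suc it) (den (Bas [IAdd 17 17 3]) (I, R))"
      using * unfolding greedy_inv_def by blast
  qed simp_all
  have 3: "triple (greedy_inv rr p it)
      (search ;; IfI 13 18 skip (Bas [IToR (-7) 18, RStore 16 (-7), IConst 8 0] ;; While 8 1 assign_body))
      ?Post (nF * (60 * nC + 22) + 4 + (0 + (nC * 32 + 4) + 2))"
    unfolding greedy_inv_def by (intro triple_exI 1)
  show ?thesis
    unfolding iterate_def by (rule triple_conseq[OF triple_Seq[OF 3 2]]) auto
qed

lemma greedy:
  assumes p: "nearest_order p"
  shows "triple (\<lambda>s. \<exists>it. encodes rr it p (\<lambda>j. None) f s) greedy
    (\<lambda>s. \<exists>\<phi> g t. encodes rr nC p \<phi> g s \<and> greedy_state t \<phi> g \<and> unconn \<phi> = {})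
    (nC * (nF * (60 * nC + 22) + nC * 32 + 22) + 2)"
proof -
  have 1: "triple (\<lambda>s. \<exists>it. encodes rr it p (\<lambda>j. None) f s) (Bas [IConst 17 0]) (greedy_inv rr p 0) 1"
  proof (rule triple_loop_free)
    fix I R assume "\<exists>it. encodes rr it p (\<lambda>j. None) f (I, R)"
    then obtain it where "encodes rr it p (\<lambda>j. None) f (I, R)" by blast
    from encodes_next[OF this, of 0]
    have "encodes rr 0 p (\<lambda>j. None) f (den (Bas [IConst 17 0]) (I, R))" by simp
    moreover have "unconn (\<lambda>j. None) = {..<nC}" by (auto simp: unconn_def)
    ultimately show "greedy_inv rr p 0 (den (Bas [IConst 17 0]) (I, R))"
      unfolding greedy_inv_def using greedy_state_init by (metis card_lessThan diff_zero order_refl)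
  qed simp_all
  have 2: "triple (greedy_inv rr p 0) (While 17 1 iterate) (greedy_inv rr p nC)
      (nC * ((nF * (60 * nC + 22) + nC * 32 + 20) + 2) + 1)"
    by (rule triple_While[where Inv = "greedy_inv rr p", OF iterate[OF p]])
      (auto simp: greedy_inv_def encodesD)
  show ?thesis
    unfolding greedy_def
    by (rule triple_conseq[OF triple_Seq[OF 1 2]]) (auto simp: greedy_inv_def)
qed

section \<open>Writing the solution\<close>

definition out_base :: "nat \<Rightarrow> (nat \<Rightarrow> nat option) \<Rightarrow> memory \<Rightarrow> bool" where
  "out_base rr \<phi> s \<longleftrightarrow> (case s of (I, R) \<Rightarrow>
     (I 0 = int nF \<and> I 1 = int nC \<and> I 2 = int rr \<and> I 3 = 1 \<and> I 4 = 40 + int nC \<and> I 5 = rp nF \<and>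
      I 18 = 0 \<and> I 19 = -20 \<and> I 21 = -1 \<and> R (-7) = 0 \<and> R (-5) = 1) \<and>
     (\<forall>j<nC. I (40 + int nC + (rp nF + int j)) = (case \<phi> j of None \<Rightarrow> 0 | Some i \<Rightarrow> rp i)) \<and>
     (\<forall>i<nF. R (-20 - int i) = real (u i)))"

lemma out_baseD:
  assumes "out_base rr \<phi> (I, R)"
  shows "I 0 = int nF" "I 1 = int nC" "I 2 = int rr" "I 3 = 1" "I 4 = 40 + int nC" "I 5 = rp nF"
    "I 18 = 0" "I 19 = -20" "I 21 = -1" "R (-7) = 0" "R (-5) = 1"
    "j < nC \<Longrightarrow> I (40 + int nC + (rp nF + int j)) = (case \<phi> j of None \<Rightarrow> 0 | Some i \<Rightarrow> rp i)"
    "i < nF \<Longrightarrow> R (-20 - int i) = real (u i)"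
  using assms by (simp_all add: out_base_def)

lemma out_base_scratchI [simp]:
  assumes "a < 0 \<or> 6 \<le> a \<and> a \<le> 17"
  shows "out_base rr \<phi> (I(a := v), R) = out_base rr \<phi> (I, R)"
proof -
  have "40 + int nC + (rp nF + int k) \<noteq> a" for k
    using assms rowptr_nonneg[of nF nC nF] by linarith
  then show ?thesis using assms by (auto simp: out_base_def)
qed

lemma out_base_scratchR [simp]:
  assumes "a \<in> {-4..<0}"
  shows "out_base rr \<phi> (I, R(a := v)) = out_base rr \<phi> (I, R)"
  using assms by (auto simp: out_base_def)

definition y_cells :: "nat \<Rightarrow> (nat \<Rightarrow> nat option) \<Rightarrow> nat \<Rightarrow> (int \<Rightarrow> int) \<Rightarrow> bool" where
  "y_cells rr \<phi> i I \<longleftrightarrow> (\<forall>i'<i. \<exists>q \<rho>. \<rho> < u i' \<and> q * u i' = load \<phi> i' nC + \<rho> \<and>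
     I (-1 - int i') = int rr * int q)"

definition x_cells :: "nat \<Rightarrow> (nat \<Rightarrow> nat option) \<Rightarrow> nat \<Rightarrow> nat \<Rightarrow> (int \<Rightarrow> int) \<Rightarrow> bool" where
  "x_cells rr \<phi> i j I \<longleftrightarrow> (\<forall>i'<nF. \<forall>j'<nC. I (-1 - (rp i' + int j')) =
     (if (i' < i \<or> i' = i \<and> j' < j) \<and> \<phi> j' = Some i' then int rr else 0))"

lemma y_cells_nonneg [simp]: "0 \<le> a \<Longrightarrow> y_cells rr \<phi> i (I(a := v)) = y_cells rr \<phi> i I"
proof -
  assume "0 \<le> a"
  then have "-1 - int i' \<noteq> a" for i' by linarith
  then show ?thesis by (simp add: y_cells_def)
qed

lemma x_cells_nonneg [simp]: "0 \<le> a \<Longrightarrow> x_cells rr \<phi> i j (I(a := v)) = x_cells rr \<phi> i j I"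
proof -
  assume "0 \<le> a"
  then have "-1 - (rp i' + int j') \<noteq> a" for i' j' using rowptr_nonneg[of nF nC i'] by linarith
  then show ?thesis by (simp add: x_cells_def)
qed

text \<open>Moves a register write past a later output write, so that the rules for nonnegative
  cells can remove it.\<close>

lemma cells_twist [simp]:
  assumes "0 \<le> a" "b < 0"
  shows "y_cells rr \<phi> i (I(a := v, b := w)) = y_cells rr \<phi> i (I(b := w))"
    "x_cells rr \<phi> i j (I(a := v, b := w)) = x_cells rr \<phi> i j (I(b := w))"
  using assms fun_upd_twist[of a b I v w] by simp_all

lemma y_cells_x:
  assumes "i \<le> nF" "y_cells rr \<phi> i I" shows "y_cells rr \<phi> i (I(-1 - (rp k + int j) := v))"
proof -
  have "-1 - int i' \<noteq> -1 - (rp k + int j)" if "i' < i" for i'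
    using rowptr_mono[of 0 k nF nC] that assms(1) by (simp add: rowptr_0)
  then show ?thesis using assms(2) by (simp add: y_cells_def)
qed

lemma x_cells_x:
  assumes "x_cells rr \<phi> i j I" "i < nF" "j < nC" "\<phi> j = Some i"
  shows "x_cells rr \<phi> i (Suc j) (I(-1 - (rp i + int j) := int rr))"
  unfolding x_cells_def
proof (intro allI impI)
  fix i' j' assume *: "i' < nF" "j' < nC"
  have "-1 - (rp i' + int j') = -1 - (rp i + int j) \<longleftrightarrow> i' = i \<and> j' = j"
    using rowptr_eq_iff[OF *(2) assms(3), of nF i' i] by linarith
  then show "(I(-1 - (rp i + int j) := int rr)) (-1 - (rp i' + int j')) =
     (if (i' < i \<or> i' = i \<and> j' < Suc j) \<and> \<phi> j' = Some i' then int rr else 0)"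
    using assms * by (auto simp: x_cells_def less_Suc_eq)
qed

lemma x_cells_skip: "x_cells rr \<phi> i j I \<Longrightarrow> \<phi> j \<noteq> Some i \<Longrightarrow> x_cells rr \<phi> i (Suc j) I"
  by (auto simp: x_cells_def less_Suc_eq)

lemma x_cells_row: "x_cells rr \<phi> i nC I \<Longrightarrow> x_cells rr \<phi> (Suc i) 0 I"
  by (auto simp: x_cells_def less_Suc_eq)

definition emit_inv where
  "emit_inv rr \<phi> i j s \<longleftrightarrow> (case s of (I, R) \<Rightarrow> out_base rr \<phi> (I, R) \<and> I 6 = int i \<and> I 7 = rp i \<and> I 8 = int j \<and>
     R (-1) = real (u i) \<and> y_cells rr \<phi> i I \<and> x_cells rr \<phi> i j I \<and>
     (\<exists>q \<rho>. \<rho> < u i \<and> q * u i = load \<phi> i j + \<rho> \<and> I 9 = int rr * int q \<and> R (-2) = real \<rho>))"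

lemma emit_body:
  assumes j: "j < nC" and i: "i < nF" and \<phi>: "valid \<phi>"
  shows "triple (emit_inv rr \<phi> i j) emit_body (emit_inv rr \<phi> i (Suc j)) 30"
proof (rule triple_loop_free)
  fix I R assume *: "emit_inv rr \<phi> i j (I, R)"
  then have st: "out_base rr \<phi> (I, R)" by (simp add: emit_inv_def)
  obtain q \<rho> where q: "\<rho> < u i" "q * u i = load \<phi> i j + \<rho>" "I 9 = int rr * int q" "R (-2) = real \<rho>"
    using * by (auto simp: emit_inv_def)
  have regs: "I 6 = int i" "I 7 = rp i" "I 8 = int j" "R (-1) = real (u i)"
    and y: "y_cells rr \<phi> i I" and x: "x_cells rr \<phi> i j I"
    using * by (simp_all add: emit_inv_def)
  note [simp] = out_baseD[OF st] j i regs
  have addr: "40 + int nC + (rp nF + int j) \<noteq> 11"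
    using rowptr_nonneg[of nF nC nF] by linarith
  have neg: "-1 - rp i - int j < 0" "-1 - rp i - int j = -1 - (rp i + int j)"
    using rowptr_nonneg[of nF nC i] by linarith+
  show "emit_inv rr \<phi> i (Suc j) (den emit_body (I, R))"
  proof (cases "\<phi> j = Some i")
    case True
    \<comment> \<open>If the last copy is full, a new one starts and the client takes one of its
      \<open>u i\<close> places; otherwise one free place is used up.\<close>
    have "\<exists>q' \<rho>'. \<rho>' < u i \<and> q' * u i = Suc (load \<phi> i j) + \<rho>' \<and>
        (if \<rho> = 0 then int rr * int q + int rr else int rr * int q) = int rr * int q' \<and>
        (if \<rho> = 0 then real (u i) - 1 else real \<rho> - 1) = real \<rho>'"
    proof (cases "\<rho> = 0")
      case True
      then show ?thesis using q u_pos[OF i]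
        by (intro exI[of _ "Suc q"] exI[of _ "u i - 1"]) (auto simp: algebra_simps of_nat_diff)
    next
      case False
      then show ?thesis using q
        by (intro exI[of _ q] exI[of _ "\<rho> - 1"]) (auto simp: of_nat_diff)
    qed
    then show ?thesis
      using addr neg True x_cells_x[OF x i j True] y_cells_x[OF less_imp_le[OF i] y, of i j] q(4) q(3) st
      by (simp add: emit_body_def skip_def emit_inv_def load_Suc diff_diff_eq split: if_splits)
  next
    case False
    \<comment> \<open>Row pointers identify sites: since there is a client, rows are nonempty and
      start at different addresses, none of them 0.\<close>
    have "(case \<phi> j of None \<Rightarrow> 0 | Some x \<Rightarrow> rp x) \<noteq> rp i"
    proof (cases "\<phi> j")
      case None
      then show ?thesis using rowptr_pos[OF i, of nC] by simp
    next
      case (Some i')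
      then show ?thesis using False rowptr_eq_iff[OF j j, of nF i' i] by auto
    qed
    then show ?thesis
      using addr False x_cells_skip[OF x False] y q st
      by (auto simp: emit_body_def skip_def emit_inv_def load_Suc)
  qed
qed (simp_all add: emit_body_def skip_def)

definition row_inv where
  "row_inv rr \<phi> i s \<longleftrightarrow> (case s of (I, R) \<Rightarrow> out_base rr \<phi> (I, R) \<and> I 6 = int i \<and> I 7 = rp i \<and>
     y_cells rr \<phi> i I \<and> x_cells rr \<phi> i 0 I)"

lemma emit_row:
  assumes i: "i < nF" and \<phi>: "valid \<phi>"
  shows "triple (row_inv rr \<phi> i) emit_row (row_inv rr \<phi> (Suc i)) (nC * 32 + 20)"
proof -
  have 1: "triple (row_inv rr \<phi> i) (Bas [ISub 10 19 6, RLoad (-1) 10, IToR (-2) 18, IConst 9 0, IConst 8 0])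
      (emit_inv rr \<phi> i 0) 5"
  proof (rule triple_loop_free)
    fix I R assume *: "row_inv rr \<phi> i (I, R)"
    then have st: "out_base rr \<phi> (I, R)" by (simp add: row_inv_def)
    show "emit_inv rr \<phi> i 0 (den (Bas [ISub 10 19 6, RLoad (-1) 10, IToR (-2) 18, IConst 9 0, IConst 8 0]) (I, R))"
      using * i u_pos[OF i] by (simp add: row_inv_def emit_inv_def out_baseD[OF st])
  qed simp_all
  have 2: "triple (emit_inv rr \<phi> i 0) (While 8 1 emit_body) (emit_inv rr \<phi> i nC) (nC * (30 + 2) + 1)"
    by (rule triple_While[where Inv = "emit_inv rr \<phi> i", OF emit_body[OF _ i \<phi>]])
      (auto simp: emit_inv_def out_baseD)
  have 3: "triple (emit_inv rr \<phi> i nC) (Bas [ISub 11 21 6, IStore 11 9, IAdd 7 7 1, IAdd 6 6 3])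
      (row_inv rr \<phi> (Suc i)) 4"
  proof (rule triple_loop_free)
    fix I R assume *: "emit_inv rr \<phi> i nC (I, R)"
    then have st: "out_base rr \<phi> (I, R)" by (simp add: emit_inv_def)
    obtain q \<rho> where q: "\<rho> < u i" "q * u i = load \<phi> i nC + \<rho>" "I 9 = int rr * int q"
      using * by (auto simp: emit_inv_def)
    have y: "y_cells rr \<phi> i I" and x: "x_cells rr \<phi> i nC I"
      using * by (simp_all add: emit_inv_def)
    have "y_cells rr \<phi> (Suc i) (I(-1 - int i := int rr * int q))"
      using y q by (auto simp: y_cells_def less_Suc_eq)
    moreover have "x_cells rr \<phi> (Suc i) 0 (I(-1 - int i := int rr * int q))"
    proof -
      have "-1 - (rp i' + int j) \<noteq> -1 - int i" for i' j
        using i rowptr_mono[of 0 i' nF nC] by (simp add: rowptr_0)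
      then show ?thesis using x_cells_row[OF x] by (simp add: x_cells_def)
    qed
    ultimately show "row_inv rr \<phi> (Suc i) (den (Bas [ISub 11 21 6, IStore 11 9, IAdd 7 7 1, IAdd 6 6 3]) (I, R))"
      using * q(3) st by (simp add: row_inv_def emit_inv_def out_baseD[OF st] rowptr_Suc)
  qed simp_all
  show ?thesis
    unfolding emit_row_def by (rule triple_conseq[OF triple_Seq[OF 1 triple_Seq[OF 2 3]]]) auto
qed

lemma emit:
  assumes \<phi>: "valid \<phi>"
  shows "triple (encodes rr it p \<phi> g) emit (\<lambda>s. y_cells rr \<phi> nF (fst s) \<and> x_cells rr \<phi> nF 0 (fst s))
    (nF * (nC * 32 + 22) + 6)"
proof -
  have 1: "triple (encodes rr it p \<phi> g)
      (Bas [IConst 6 0, IAdd 7 0 18, IToR (-7) 18, IToR (-5) 3, IConst 21 (-1)]) (row_inv rr \<phi> 0) 5"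
  proof (rule triple_loop_free)
    fix I R assume st: "encodes rr it p \<phi> g (I, R)"
    have addr: "40 + int nC + (rp nF + int k) \<noteq> a" if "a < 40" for k a
      using rowptr_nonneg[of nF nC nF] that by linarith
    have "-1 - (rp i' + int j) < 0" for i' j using rowptr_nonneg[of nF nC i'] by linarith
    then have "x_cells rr \<phi> 0 0 I" using encodesD(10)[OF st] by (simp add: x_cells_def)
    then show "row_inv rr \<phi> 0 (den (Bas [IConst 6 0, IAdd 7 0 18, IToR (-7) 18, IToR (-5) 3, IConst 21 (-1)]) (I, R))"
      using addr by (simp add: row_inv_def out_base_def encodesD[OF st] rowptr_0 y_cells_def)
  qed simp_all
  have 2: "triple (row_inv rr \<phi> 0) (While 6 0 emit_row) (row_inv rr \<phi> nF) (nF * ((nC * 32 + 20) + 2) + 1)"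
    by (rule triple_While[where Inv = "row_inv rr \<phi>", OF emit_row[OF _ \<phi>]])
      (auto simp: row_inv_def out_baseD)
  show ?thesis
    unfolding emit_def by (rule triple_conseq[OF triple_Seq[OF 1 2]]) (auto simp: row_inv_def)
qed

section \<open>Sorting the clients around each site by rank\<close>

definition closer :: "nat \<Rightarrow> nat \<Rightarrow> nat \<Rightarrow> bool" where
  "closer i l j \<longleftrightarrow> d i l < d i j \<or> d i l = d i j \<and> l < j"

definition rank :: "nat \<Rightarrow> nat \<Rightarrow> nat" where
  "rank i j = card {l. l < nC \<and> closer i l j}"

definition order :: "nat \<Rightarrow> nat \<Rightarrow> nat" where
  "order i = inv_into {..<nC} (rank i)"

lemma rank_mono:
  assumes "closer i l j" "l < nC" shows "rank i l < rank i j"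
  unfolding rank_def
proof (rule psubset_card_mono)
  have "l \<in> {l'. l' < nC \<and> closer i l' j}" "l \<notin> {l'. l' < nC \<and> closer i l' l}"
    using assms by (auto simp: closer_def)
  moreover have "{l'. l' < nC \<and> closer i l' l} \<subseteq> {l'. l' < nC \<and> closer i l' j}"
    using assms(1) by (auto simp: closer_def)
  ultimately show "{l'. l' < nC \<and> closer i l' l} \<subset> {l'. l' < nC \<and> closer i l' j}" by blast
qed simp

lemma rank_less: assumes "j < nC" shows "rank i j < nC"
proof -
  have "rank i j < card {..<nC}"
    unfolding rank_def
  proof (rule psubset_card_mono)
    have "\<not> closer i j j" by (simp add: closer_def)
    then show "{l. l < nC \<and> closer i l j} \<subset> {..<nC}" using assms by blast
  qed simp
  then show ?thesis by simp
qed

text \<open>Two distinct clients are always comparable by \<open>closer\<close>, so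
  \<open>rank_mono\<close> separates their ranks; an injection of a finite set into itself is
  onto.\<close>

lemma rank_bij: "bij_betw (rank i) {..<nC} {..<nC}"
proof -
  have "inj_on (rank i) {..<nC}"
  proof (rule inj_onI)
    fix j l assume "j \<in> {..<nC}" "l \<in> {..<nC}" "rank i j = rank i l"
    then have "\<not> closer i j l" "\<not> closer i l j" using rank_mono by fastforce+
    then show "j = l" by (auto simp: closer_def)
  qed
  moreover have "rank i ` {..<nC} \<subseteq> {..<nC}" using rank_less by auto
  ultimately show ?thesis using endo_inj_surj[of "{..<nC}" "rank i"] by (simp add: bij_betw_def)
qed

lemma rank_order: "k < nC \<Longrightarrow> order i k < nC \<and> rank i (order i k) = k"
  using bij_betw_imp_surj_on[OF rank_bij, of i] inv_into_into[of k "rank i" "{..<nC}"]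
    f_inv_into_f[of k "rank i" "{..<nC}"] by (simp add: order_def)

lemma nearest_order: "nearest_order order"
  unfolding nearest_order_def
proof (intro allI impI conjI)
  fix i show "bij_betw (order i) {..<nC} {..<nC}"
    unfolding order_def by (rule bij_betw_inv_into[OF rank_bij])
  fix k' k :: nat assume "k' \<le> k" "k < nC"
  then have "\<not> closer i (order i k) (order i k')"
    using rank_mono[of i "order i k" "order i k'"] rank_order[of k i] rank_order[of k' i] by auto
  then show "d i (order i k') \<le> d i (order i k)" by (auto simp: closer_def)
qed

text \<open>Rows \<open>i' < i\<close> are finished; in row \<open>i\<close> the first \<open>j\<close> costs carry the surcharge and the first \<open>m\<close>
  clients are stored at their rank.\<close>

definition prep :: "nat \<Rightarrow> nat \<Rightarrow> nat \<Rightarrow> nat \<Rightarrow> memory \<Rightarrow> bool" where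
  "prep rr i j m s \<longleftrightarrow> (case s of (I, R) \<Rightarrow>
     (I 0 = int nF \<and> I 1 = int nC \<and> I 2 = int rr \<and> I 3 = 1 \<and> I 4 = 40 + int nC \<and> I 6 = int i \<and> I 7 = rp i \<and>
      I 18 = 0 \<and> I 19 = -20) \<and> (\<forall>a<0. I a = 0) \<and>
     (\<forall>i'<i. \<forall>k<nC. I (40 + int nC + rp i' + int k) = int (order i' k)) \<and>
     (\<forall>l<m. I (40 + int nC + rp i + int (rank i l)) = int l) \<and>
     (\<forall>l<nC. I (40 + int nC + (rp nF + int l)) = 0) \<and>
     (\<forall>i'<nF. R (int i') = f i') \<and>
     (\<forall>i'<nF. \<forall>l<nC. R (rp i' + int l) = (if i' < i \<or> i' = i \<and> l < j then d i' l else c i' l)) \<and>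
     (\<forall>i'<nF. R (-20 - int i') = real (u i')))"

lemma prepD:
  assumes "prep rr i j m (I, R)"
  shows "I 0 = int nF" "I 1 = int nC" "I 2 = int rr" "I 3 = 1" "I 4 = 40 + int nC" "I 6 = int i" "I 7 = rp i"
    "I 18 = 0" "I 19 = -20" "a < 0 \<Longrightarrow> I a = 0"
    "i' < i \<Longrightarrow> k < nC \<Longrightarrow> I (40 + int nC + rp i' + int k) = int (order i' k)"
    "l < m \<Longrightarrow> I (40 + int nC + rp i + int (rank i l)) = int l"
    "l < nC \<Longrightarrow> I (40 + int nC + (rp nF + int l)) = 0"
    "i' < nF \<Longrightarrow> R (int i') = f i'"
    "i' < nF \<Longrightarrow> l < nC \<Longrightarrow> R (rp i' + int l) = (if i' < i \<or> i' = i \<and> l < j then d i' l else c i' l)"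
    "i' < nF \<Longrightarrow> R (-20 - int i') = real (u i')"
  using assms by (simp_all add: prep_def)

lemma prep_scratchI [simp]:
  assumes "8 \<le> a \<and> a \<le> 17"
  shows "prep rr i j m (I(a := v), R) = prep rr i j m (I, R)"
proof -
  have "40 + int nC + rp i' + int k \<noteq> a" "40 + int nC + (rp nF + int k) \<noteq> a" for i' k
    using assms rowptr_nonneg[of nF nC i'] rowptr_nonneg[of nF nC nF] by linarith+
  moreover have "(\<forall>b<0. (I(a := v)) b = 0) = (\<forall>b<0. I b = 0)"
    using assms by (intro all_cong) auto
  ultimately show ?thesis using assms unfolding prep_def by (simp del: fun_upd_apply) auto
qed

lemma prep_scratchR [simp]:
  assumes "-19 \<le> a \<and> a < 0"
  shows "prep rr i j m (I, R(a := v)) = prep rr i j m (I, R)"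
proof -
  have "int i' \<noteq> a" "rp i' + int k \<noteq> a" "-20 - int i' \<noteq> a" for i' k
    using assms rowptr_nonneg[of nF nC i'] by linarith+
  then show ?thesis by (simp add: prep_def)
qed

lemma prep_charge:
  assumes st: "prep rr i j m (I, R)" and i: "i < nF" and j: "j < nC"
  shows "prep rr i (Suc j) m (I, R(rp i + int j := d i j))"
proof -
  have "int i' \<noteq> rp i + int j" if "i' < nF" for i'
    using that rowptr_mono[of 0 i nF nC] by (simp add: rowptr_0)
  moreover have "-20 - int i' \<noteq> rp i + int j" for i'
    using rowptr_nonneg[of nF nC i] by linarith
  moreover have "rp i' + int l = rp i + int j \<longleftrightarrow> i' = i \<and> l = j" if "l < nC" for i' l
    by (rule rowptr_eq_iff[OF that j])
  ultimately show ?thesis using st by (auto simp: prep_def less_Suc_eq)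
qed

lemma prep_place:
  assumes st: "prep rr i j m (I, R)" and i: "i < nF" and m: "m < nC"
  shows "prep rr i j (Suc m) (I(40 + int nC + rp i + int (rank i m) := int m), R)"
proof -
  let ?a = "40 + int nC + rp i + int (rank i m)"
  have a: "?a \<ge> 40" using rowptr_nonneg[of nF nC i] by linarith
  have 1: "40 + int nC + rp i' + int k = ?a \<longleftrightarrow> i' = i \<and> k = rank i m" if "k < nC" for i' k
    using rowptr_eq_iff[OF that rank_less[OF m], of nF i' i i] by linarith
  have 2: "40 + int nC + (rp nF + int k) \<noteq> ?a" for k
    using rowptr_less[OF i, of nF nC] rank_less[OF m, of i] by linarith
  have 3: "rank i l = rank i m \<longleftrightarrow> l = m" if "l < nC" for l
    using inj_on_eq_iff[OF bij_betw_imp_inj_on[OF rank_bij]] that m by simp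
  have "(I(?a := int m)) b = I b" if "b < 40" for b using a that by simp
  moreover have "(I(?a := int m)) (40 + int nC + rp i' + int k) = I (40 + int nC + rp i' + int k)"
    if "i' < i" "k < nC" for i' k using 1[of k i'] that by simp
  moreover have "(I(?a := int m)) (40 + int nC + rp i + int (rank i l)) = int l" if "l < Suc m" for l
    using 3[of l] that m prepD(12)[OF st, of l] by (auto simp: less_Suc_eq)
  moreover have "(I(?a := int m)) (40 + int nC + (rp nF + int l)) = I (40 + int nC + (rp nF + int l))" for l
    using 2 by simp
  ultimately show ?thesis using st unfolding prep_def prod.case
    by (simp del: fun_upd_apply)
qed

lemma prep_row:
  assumes "prep rr i nC nC (I, R)" "i < nF"
  shows "prep rr (Suc i) 0 0 (I(7 := rp i + int nC, 6 := int i + 1), R)"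
proof -
  have "40 + int nC + rp i' + int k \<noteq> 7" "40 + int nC + (rp nF + int k) \<noteq> 7"
    "40 + int nC + rp i' + int k \<noteq> 6" "40 + int nC + (rp nF + int k) \<noteq> 6" for i' k
    using rowptr_nonneg[of nF nC i'] rowptr_nonneg[of nF nC nF] by linarith+
  \<comment> \<open>Storing every client at its rank tabulates the inverse of \<open>rank i\<close>,
    which is \<open>order i\<close>.\<close>
  moreover have "I (40 + int nC + rp i + int k) = int (order i k)" if "k < nC" for k
    using prepD(12)[OF assms(1), of "order i k"] rank_order[OF that, of i] by simp
  ultimately show ?thesis using assms by (auto simp: prep_def less_Suc_eq rowptr_Suc)
qed

definition charge_inv where
  "charge_inv rr i j s \<longleftrightarrow> (case s of (I, R) \<Rightarrow> prep rr i j 0 (I, R) \<and> I 8 = int j \<and> R (-1) = h i)"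

lemma charge_body:
  assumes j: "j < nC" and i: "i < nF"
  shows "triple (charge_inv rr i j) charge_body (charge_inv rr i (Suc j)) 5"
proof (rule triple_loop_free)
  fix I R assume *: "charge_inv rr i j (I, R)"
  then have st: "prep rr i j 0 (I, R)" by (simp add: charge_inv_def)
  have addr: "rp i + int j \<noteq> -1" "rp i + int j \<noteq> -2"
    using rowptr_nonneg[of nF nC i] by linarith+
  have "prep rr i (Suc j) 0 (I, R(-2 := d i j, rp i + int j := d i j))"
    using prep_charge[OF _ i j, of rr 0 I "R(-2 := d i j)"] st by simp
  then show "charge_inv rr i (Suc j) (den charge_body (I, R))"
    using * addr i j by (simp add: charge_body_def charge_inv_def prepD[OF st] d_def[symmetric])
qed (simp_all add: charge_body_def)

definition count_inv where
  "count_inv rr i j l s \<longleftrightarrow> (case s of (I, R) \<Rightarrow> prep rr i nC j (I, R) \<and> I 8 = int j \<and> R (-2) = d i j \<and>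
     I 9 = int l \<and> I 10 = int (card {k. k < l \<and> closer i k j}))"

lemma count_body:
  assumes l: "l < nC" and i: "i < nF"
  shows "triple (count_inv rr i j l) count_body (count_inv rr i j (Suc l)) 12"
proof (rule triple_loop_free)
  fix I R assume *: "count_inv rr i j l (I, R)"
  then have st: "prep rr i nC j (I, R)" by (simp add: count_inv_def)
  have addr: "rp i + int l \<noteq> -2" "rp i + int l \<noteq> -3"
    using rowptr_nonneg[of nF nC i] by linarith+
  have set: "{k. k < Suc l \<and> closer i k j} =
      (if closer i l j then insert l {k. k < l \<and> closer i k j} else {k. k < l \<and> closer i k j})"
    by (auto simp: less_Suc_eq)
  have "card {k. k < Suc l \<and> closer i k j} =
      (if closer i l j then Suc (card {k. k < l \<and> closer i k j}) else card {k. k < l \<and> closer i k j})"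
    unfolding set by simp
  then show "count_inv rr i j (Suc l) (den count_body (I, R))"
    using * addr i l by (auto simp: count_body_def skip_def count_inv_def prepD[OF st] closer_def)
qed (simp_all add: count_body_def skip_def)

definition place_inv where
  "place_inv rr i j s \<longleftrightarrow> (case s of (I, R) \<Rightarrow> prep rr i nC j (I, R) \<and> I 8 = int j)"

lemma place_body:
  assumes j: "j < nC" and i: "i < nF"
  shows "triple (place_inv rr i j) place_body (place_inv rr i (Suc j)) (nC * 14 + 10)"
proof -
  have 1: "triple (place_inv rr i j) (Bas [IAdd 11 7 8, RLoad (-2) 11, IConst 9 0, IConst 10 0])
      (count_inv rr i j 0) 4"
  proof (rule triple_loop_free)
    fix I R assume *: "place_inv rr i j (I, R)"
    then have st: "prep rr i nC j (I, R)" by (simp add: place_inv_def)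
    show "count_inv rr i j 0 (den (Bas [IAdd 11 7 8, RLoad (-2) 11, IConst 9 0, IConst 10 0]) (I, R))"
      using * i j by (simp add: place_inv_def count_inv_def prepD[OF st])
  qed simp_all
  have 2: "triple (count_inv rr i j 0) (While 9 1 count_body) (count_inv rr i j nC) (nC * (12 + 2) + 1)"
    by (rule triple_While[where Inv = "count_inv rr i j", OF count_body[OF _ i]])
      (auto simp: count_inv_def prepD)
  have 3: "triple (count_inv rr i j nC) (Bas [IAdd 11 4 7, IAdd 11 11 10, IStore 11 8, IAdd 8 8 3])
      (place_inv rr i (Suc j)) 4"
  proof (rule triple_loop_free)
    fix I R assume *: "count_inv rr i j nC (I, R)"
    then have st: "prep rr i nC j (I, R)" by (simp add: count_inv_def)
    let ?a = "40 + int nC + rp i + int (rank i j)"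
    have addr: "?a \<noteq> 11" "?a \<noteq> 8" "?a \<noteq> 3" using rowptr_nonneg[of nF nC i] by linarith+
    have "prep rr i nC (Suc j) (I(11 := ?a, ?a := int j), R)"
      using prep_place[OF _ i j, of rr nC "I(11 := ?a)" R] st by simp
    then show "place_inv rr i (Suc j) (den (Bas [IAdd 11 4 7, IAdd 11 11 10, IStore 11 8, IAdd 8 8 3]) (I, R))"
      using * addr by (simp add: place_inv_def count_inv_def prepD[OF st] rank_def[symmetric])
  qed simp_all
  show ?thesis
    unfolding place_body_def by (rule triple_conseq[OF triple_Seq[OF 1 triple_Seq[OF 2 3]]]) auto
qed

lemma prep_row_body:
  assumes i: "i < nF"
  shows "triple (prep rr i 0 0) prep_row_body (prep rr (Suc i) 0 0) (nC * (nC * 14 + 20) + 20)"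
proof -
  have 1: "triple (prep rr i 0 0) (Bas [ISub 10 19 6, RLoad (-1) 10, RLoad (-2) 6, RDiv (-1) (-2) (-1), IConst 8 0])
      (charge_inv rr i 0) 5"
  proof (rule triple_loop_free)
    fix I R assume st: "prep rr i 0 0 (I, R)"
    then show "charge_inv rr i 0
        (den (Bas [ISub 10 19 6, RLoad (-1) 10, RLoad (-2) 6, RDiv (-1) (-2) (-1), IConst 8 0]) (I, R))"
      using i by (simp add: charge_inv_def prepD[OF st] h_def)
  qed simp_all
  have 2: "triple (charge_inv rr i 0) (While 8 1 charge_body) (charge_inv rr i nC) (nC * (5 + 2) + 1)"
    by (rule triple_While[where Inv = "charge_inv rr i", OF charge_body[OF _ i]])
      (auto simp: charge_inv_def prepD)
  have 3: "triple (charge_inv rr i nC) (Bas [IConst 8 0]) (place_inv rr i 0) 1"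
    by (rule triple_loop_free) (auto simp: charge_inv_def place_inv_def)
  have 4: "triple (place_inv rr i 0) (While 8 1 place_body) (place_inv rr i nC) (nC * ((nC * 14 + 10) + 2) + 1)"
    by (rule triple_While[where Inv = "place_inv rr i", OF place_body[OF _ i]])
      (auto simp: place_inv_def prepD)
  have 5: "triple (place_inv rr i nC) (Bas [IAdd 7 7 1, IAdd 6 6 3]) (prep rr (Suc i) 0 0) 2"
  proof (rule triple_loop_free)
    fix I R assume "place_inv rr i nC (I, R)"
    then have st: "prep rr i nC nC (I, R)" by (simp add: place_inv_def)
    show "prep rr (Suc i) 0 0 (den (Bas [IAdd 7 7 1, IAdd 6 6 3]) (I, R))"
      using prep_row[OF st i] by (simp add: prepD[OF st])
  qed simp_all
  show ?thesis
    unfolding prep_row_body_def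
    by (rule triple_conseq[OF triple_Seq[OF 1 triple_Seq[OF 2 triple_Seq[OF 3 triple_Seq[OF 4 5]]]]])
      (auto simp: algebra_simps)
qed

lemma prepare:
  "triple (prep rr 0 0 0) prepare (encodes rr 0 order (\<lambda>j. None) f)
    (nF * (nC * (nC * 14 + 20) + 22) + 3)"
proof -
  have 1: "triple (prep rr 0 0 0) (While 6 0 prep_row_body) (prep rr nF 0 0) (nF * ((nC * (nC * 14 + 20) + 20) + 2) + 1)"
    by (rule triple_While[where Inv = "\<lambda>i. prep rr i 0 0", OF prep_row_body]) (auto simp: prepD)
  have 2: "triple (prep rr nF 0 0) (Bas [IAdd 5 7 18, IConst 17 0]) (encodes rr 0 order (\<lambda>j. None) f) 2"
  proof (rule triple_loop_free)
    fix I R assume st: "prep rr nF 0 0 (I, R)"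
    have "40 + int nC + rp i + int k \<noteq> a" "40 + int nC + (rp nF + int k) \<noteq> a" if "a < 40" for i k a
      using that rowptr_nonneg[of nF nC i] rowptr_nonneg[of nF nC nF] by linarith+
    then show "encodes rr 0 order (\<lambda>j. None) f (den (Bas [IAdd 5 7 18, IConst 17 0]) (I, R))"
      by (simp add: encodes_def prepD[OF st])
  qed simp_all
  show ?thesis
    unfolding prepare_def by (rule triple_conseq[OF triple_Seq[OF 1 2]]) auto
qed

section \<open>Reading the input\<close>

definition load_inv where
  "load_inv I0 R0 k s \<longleftrightarrow> (case s of (I, R) \<Rightarrow> (\<forall>a\<ge>0. I a = I0 a) \<and> (\<forall>a. a < -5 \<longrightarrow> I a = (0::int)) \<and>
     I (-1) = int k \<and> I (-2) = 1 \<and> I (-3) = 2 + int nC + int k \<and> I (-5) = -20 - int k \<and>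
     (\<forall>a\<ge>0. R a = R0 a) \<and> (\<forall>i<k. R (-20 - int i) = real (u i)))"

lemma load_caps:
  assumes nC: "0 < nC" and r: "\<And>j. j < nC \<Longrightarrow> r j = rr"
  shows "triple (\<lambda>s. s = snd (init_state nF nC f u c r)) load_caps (prep rr 0 0 0) (nF * 8 + 18)"
proof -
  obtain I0 R0 where init: "snd (init_state nF nC f u c r) = (I0, R0)" by fastforce
  \<comment> \<open>Cell 2 of the input is \<open>r 0\<close>, the common requirement; it is there
    because a client exists.\<close>
  have I0: "I0 0 = int nF" "I0 1 = int nC" "I0 2 = int rr"
    and caps: "\<And>i. i < nF \<Longrightarrow> I0 (2 + int nC + int i) = int (u i)"
    and zero: "\<And>a. a < 0 \<Longrightarrow> I0 a = 0" "\<And>a. 2 + int nC + int nF \<le> a \<Longrightarrow> I0 a = 0"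
    and R0: "\<And>i. i < nF \<Longrightarrow> R0 (int i) = f i"
    using init nC r[OF nC] by (auto simp: init_state_def)
  have cost: "R0 (rp i + int l) = c i l" if i: "i < nF" and l: "l < nC" for i l
  proof -
    have "rp i + int l < int nF + int nF * int nC"
      using rowptr_less[OF i, of nF nC] l by (simp add: rowptr_def)
    moreover have "(rp i + int l - int nF) div int nC = int i" "(rp i + int l - int nF) mod int nC = int l"
      using l by (simp_all add: rowptr_def)
    moreover have "int nF \<le> rp i + int l" by (simp add: rowptr_def)
    ultimately show ?thesis using init by (auto simp: init_state_def)
  qed
  have 1: "triple (\<lambda>s. s = (I0, R0)) (Bas [IConst (-2) 1, IConst (-1) 0, IConst (-3) 2, IAdd (-3) (-3) 1, IConst (-5) (-20)])
      (load_inv I0 R0 0) 5"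
    by (rule triple_loop_free) (auto simp: load_inv_def I0 zero)
  have body: "triple (load_inv I0 R0 k) load_body (load_inv I0 R0 (Suc k)) 6" if k: "k < nF" for k
  proof (rule triple_loop_free)
    fix I R assume *: "load_inv I0 R0 k (I, R)"
    then have "I (2 + int nC + int k) = int (u k)" using caps[OF k] by (simp add: load_inv_def)
    then show "load_inv I0 R0 (Suc k) (den load_body (I, R))"
      using * by (auto simp: load_body_def load_inv_def less_Suc_eq)
  qed (simp_all add: load_body_def)
  have 2: "triple (load_inv I0 R0 0) (While (-1) 0 load_body) (load_inv I0 R0 nF) (nF * (6 + 2) + 1)"
    by (rule triple_While[where Inv = "load_inv I0 R0", OF body]) (auto simp: load_inv_def I0)
  have 3: "triple (load_inv I0 R0 nF) (Bas [IConst (-1) 0, IConst (-2) 0, IConst (-3) 0, IConst (-4) 0,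
      IConst (-5) 0, IConst 3 1, IConst 4 40, IAdd 4 4 1, IConst 18 0, IConst 19 (-20), IConst 6 0,
      IAdd 7 0 18]) (prep rr 0 0 0) 12" (is "triple _ ?c _ _")
  proof (rule triple_loop_free)
    fix I R assume *: "load_inv I0 R0 nF (I, R)"
    have big: "40 + int nC + (rp nF + int l) \<noteq> a" if "a < 40" for l a
      using that rowptr_nonneg[of nF nC nF] by linarith
    \<comment> \<open>The assignment cells lie beyond the integer input, so they are 0 from the
      start and every client begins unconnected.\<close>
    have phi: "I (40 + int nC + (rp nF + int l)) = 0" for l
    proof -
      have "2 + int nC + int nF \<le> 40 + int nC + (rp nF + int l)"
        using rowptr_mono[of 0 nF nF nC] by (simp add: rowptr_0)
      then show ?thesis using * zero(2) by (simp add: load_inv_def)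
    qed
    have "R (rp i + int l) = c i l" if "i < nF" "l < nC" for i l
      using * cost[OF that] rowptr_nonneg[of nF nC i] by (simp add: load_inv_def)
    moreover have "I a = 0" if "a < 0" "a \<noteq> -1" "a \<noteq> -2" "a \<noteq> -3" "a \<noteq> -4" "a \<noteq> -5" for a
    proof -
      have "a < -5" using that by linarith
      then show ?thesis using * by (simp add: load_inv_def)
    qed
    ultimately show "prep rr 0 0 0 (den ?c (I, R))"
      using * big phi R0 by (simp add: prep_def load_inv_def I0 rowptr_0)
  qed simp_all
  show ?thesis
    unfolding load_caps_def init by (rule triple_conseq[OF triple_Seq[OF 1 triple_Seq[OF 2 3]]]) auto
qed

section \<open>The whole program and its running time\<close>

definition solves where
  "solves r s \<longleftrightarrow> feasible nF nC u r (out_y s) (out_x nF nC s) \<and>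
     (\<forall>y' x'. feasible nF nC u r y' x' \<longrightarrow>
       total_cost nF nC f c (out_y s) (out_x nF nC s) \<le> 2 * total_cost nF nC f c y' x')"

lemma solve:
  assumes nC: "0 < nC" and r: "\<And>j. j < nC \<Longrightarrow> r j = rr"
  shows "triple (\<lambda>s. s = snd (init_state nF nC f u c r)) solve (\<lambda>s. \<forall>p. solves r (p, s))
    (900 * (nF + nC) ^ 3)"
proof -
  let ?fin = "\<lambda>s. \<exists>\<phi> g t. encodes rr nC order \<phi> g s \<and> greedy_state t \<phi> g \<and> unconn \<phi> = {}"
  let ?T = "nF * (nC * 32 + 22) + 6"
  have "triple (\<lambda>s. encodes rr nC order \<phi> g s \<and> greedy_state t \<phi> g \<and> unconn \<phi> = {}) emit
      (\<lambda>s. \<forall>p. solves r (p, s)) ?T" for \<phi> g t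
  proof (cases "greedy_state t \<phi> g \<and> unconn \<phi> = {}")
    case True
    then have st: "greedy_state t \<phi> g" and all: "unconn \<phi> = {}" by auto
    have "solves r (p, s)" if y: "y_cells rr \<phi> nF (fst s)" and x: "x_cells rr \<phi> nF 0 (fst s)" for p s
    proof -
      let ?y = "out_y (p, s)" and ?x = "out_x nF nC (p, s)"
      have "\<forall>i. \<exists>q. i < nF \<longrightarrow> (\<exists>\<rho><u i. q * u i = load \<phi> i nC + \<rho>) \<and> fst s (-1 - int i) = int rr * int q"
        using y unfolding y_cells_def by blast
      then obtain q where q: "\<And>i. i < nF \<Longrightarrow> \<exists>\<rho><u i. q i * u i = load \<phi> i nC + \<rho>"
        and yq: "\<And>i. i < nF \<Longrightarrow> fst s (-1 - int i) = int rr * int (q i)" by metis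
      have yv: "?y i = int rr * int (q i)" if "i < nF" for i
      proof -
        have "- (1 + int i) = -1 - int i" by simp
        then show ?thesis using yq[OF that] by (simp only: out_y_def snd_conv)
      qed
      have xv: "?x i j = (if \<phi> j = Some i then int rr else 0)" if "i < nF" "j < nC" for i j
      proof -
        have "- (1 + int nF + int i * int nC + int j) = -1 - (rp i + int j)" by (simp add: rowptr_def)
        then show ?thesis using x that by (simp only: out_x_def snd_conv x_cells_def) simp
      qed
      show ?thesis
        unfolding solves_def
      proof (intro conjI allI impI)
        show "feasible nF nC u r ?y ?x"
          by (rule greedy_solution(1)[OF st all, where rr = rr and q = q]) (fact r q yv xv)+
        show "total_cost nF nC f c ?y ?x \<le> 2 * total_cost nF nC f c y' x'"
          if "feasible nF nC u r y' x'" for y' x'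
          by (rule greedy_solution(2)[OF st all, where rr = rr and q = q]) (fact r q yv xv that)+
      qed
    qed
    then show ?thesis
      by (intro triple_conseq[OF emit[OF greedy_state_valid[OF st]]]) auto
  qed (auto simp: triple_def)
  then have 4: "triple ?fin emit (\<lambda>s. \<forall>p. solves r (p, s)) ?T"
    by (intro triple_exI)
  have 3: "triple (encodes rr 0 order (\<lambda>j. None) f) greedy ?fin (nC * (nF * (60 * nC + 22) + nC * 32 + 22) + 2)"
    by (rule triple_conseq[OF greedy[OF nearest_order]]) auto
  \<comment> \<open>Every monomial has degree at most 3 and, padded with factors 1, is at most
    \<open>(nF + nC) ^ 3\<close>. The coefficients add up to 283, so 900 is ample.\<close>
  have time: "nF * 8 + 18 + (nF * (nC * (nC * 14 + 20) + 22) + 3 +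
      (nC * (nF * (60 * nC + 22) + nC * 32 + 22) + 2 + ?T)) \<le> 900 * (nF + nC) ^ 3"
  proof -
    have n: "nF \<le> nF + nC" "nC \<le> nF + nC" "1 \<le> nF + nC" using nC by auto
    have "x * (y * z) \<le> (nF + nC) ^ 3" if "x \<le> nF + nC" "y \<le> nF + nC" "z \<le> nF + nC" for x y z
      using mult_le_mono[OF that(1) mult_le_mono[OF that(2,3)]] by (simp add: power3_eq_cube mult.assoc)
    note this[OF n(1) n(2) n(2)] this[OF n(1) n(2) n(3)] this[OF n(2) n(2) n(3)]
      this[OF n(1) n(3) n(3)] this[OF n(2) n(3) n(3)] this[OF n(3) n(3) n(3)]
    then show ?thesis by (simp add: algebra_simps)
  qed
  show ?thesis
    unfolding solve_def
    by (rule triple_conseq[OF triple_Seq[OF load_caps[OF nC r] triple_Seq[OF prepare triple_Seq[OF 3 4]]]])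
      (use time in auto)
qed

end

text \<open>Cell \<open>-1\<close> is 0 at the start, so the test asks whether there are no clients.
  Then cell 2 holds no requirement, and the memory already describes the empty solution.\<close>

definition program :: "instr list" where
  "program = compile 0 (IfI 1 (-1) skip solve)"

lemma wf_solve: "wf solve"
  by (simp add: solve_def load_caps_def load_body_def prepare_def prep_row_body_def charge_body_def
      place_body_def count_body_def greedy_def iterate_def search_def site_body_def saving_body_def
      scan_body_def set_best_def assign_body_def set_site_def emit_def emit_row_def emit_body_def skip_def)

lemma run_program:
  assumes "big (IfI 1 (-1) skip solve) s k s'"
  shows "run program k (0, s) = (length program, s')"
proof -
  have "code_at program 0 (compile 0 (IfI 1 (-1) skip solve))"
    unfolding code_at_def program_def by (intro exI[of _ "[]"]) simp
  moreover have "wf (IfI 1 (-1) skip solve)" using wf_solve by (simp add: skip_def)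
  ultimately show ?thesis
    using big_imp_run[OF assms] by (simp add: run_def program_def)
qed

lemma halted_end: "halted P (length P, s)"
  by (simp add: halted_def)

theorem mainTheorem4:
  shows "\<exists>(P :: instr list) (K :: real).
    \<forall>nF nC f u c r.
      cuftra_instance nF nC f u c r \<and> metric_instance nF nC c \<and> uniform_requirements nC r \<longrightarrow>
      (\<exists>k. real k \<le> K * (real (nF + nC) ^ 3 * real (max_req nC r) + 1) \<and>
           (let s = run P k (init_state nF nC f u c r) in
              halted P s \<and>
              feasible nF nC u r (out_y s) (out_x nF nC s) \<and>
              (\<forall>y' x'. feasible nF nC u r y' x' \<longrightarrow>
                 total_cost nF nC f c (out_y s) (out_x nF nC s) \<le> 289/100 * total_cost nF nC f c y' x')))"
proof (rule exI[of _ program], rule exI[of _ 900], intro allI impI)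
  fix nF nC f u c r
  assume inst: "cuftra_instance nF nC f u c r \<and> metric_instance nF nC c \<and> uniform_requirements nC r"
  define s0 where "s0 = snd (init_state nF nC f u c r)"
  have init: "init_state nF nC f u c r = (0, s0)" by (simp add: s0_def init_state_def)
  have nonneg: "0 \<le> total_cost nF nC f c y x" if "feasible nF nC u r y x" for y x
    using that inst unfolding total_cost_def feasible_def cuftra_instance_def
    by (intro add_nonneg_nonneg sum_nonneg mult_nonneg_nonneg) auto
  have "\<exists>k s'. big (IfI 1 (-1) skip solve) s0 k s' \<and>
    real k \<le> 900 * (real (nF + nC) ^ 3 * real (max_req nC r) + 1) \<and>
    feasible nF nC u r (out_y (length program, s')) (out_x nF nC (length program, s')) \<and>
    (\<forall>y' x'. feasible nF nC u r y' x' \<longrightarrow>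
       total_cost nF nC f c (out_y (length program, s')) (out_x nF nC (length program, s'))
         \<le> 2 * total_cost nF nC f c y' x')"
  proof (cases "nC = 0")
    case True
    \<comment> \<open>Here \<open>max_req\<close> is 0, and the single step is covered by the
      summand 1 in the time bound.\<close>
    have "fst s0 1 \<le> fst s0 (-1)" using True by (simp add: s0_def init_state_def)
    moreover have "big skip s0 0 s0" unfolding skip_def using big.Bas[of "[]" s0] by simp
    ultimately have "big (IfI 1 (-1) skip solve) s0 (Suc 0) s0" by (rule big.IfIT)
    moreover have "out_y (length program, s0) i = 0" for i
      by (simp add: out_y_def s0_def init_state_def)
    ultimately show ?thesis
      using True nonneg
      by (intro exI[of _ "Suc 0"] exI[of _ s0]) (auto simp: feasible_def total_cost_def max_req_def)
  next
    case False
    obtain rr where rr: "\<And>j. j < nC \<Longrightarrow> r j = rr" "0 < rr"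
      using inst by (auto simp: uniform_requirements_def)
    interpret metric_cuftra nF nC f u c
      by unfold_locales (use inst in \<open>auto simp: cuftra_instance_def metric_instance_def\<close>)
    obtain k s' where k: "big solve s0 k s'" "k \<le> 900 * (nF + nC) ^ 3" and s': "\<And>p. solves r (p, s')"
    proof -
      have "triple (\<lambda>s. s = s0) solve (\<lambda>s. \<forall>p. solves r (p, s)) (900 * (nF + nC) ^ 3)"
        unfolding s0_def by (rule solve[where rr = rr]) (use False rr(1) in auto)
      then show thesis using that unfolding triple_def by blast
    qed
    have "\<not> fst s0 1 \<le> fst s0 (-1)" using False by (simp add: s0_def init_state_def)
    then have big: "big (IfI 1 (-1) skip solve) s0 (Suc (Suc k)) s'" using k(1) by (rule big.IfIF)
    have "r 0 \<le> max_req nC r" using False by (auto simp: max_req_def)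
    then have "1 \<le> max_req nC r" using rr False by auto
    then have "N \<le> N * max_req nC r" for N by simp
    \<comment> \<open>The two extra steps, the initial test and the jump at the end of
      \<open>solve\<close>, are absorbed by the summand 1.\<close>
    moreover have "Suc (Suc k) \<le> 900 * (N * m + 1)" if "k \<le> 900 * N" "N \<le> N * m" for N m
      using order_trans[OF that(1) mult_le_mono2[OF that(2)]] by (simp add: algebra_simps)
    ultimately have "Suc (Suc k) \<le> 900 * ((nF + nC) ^ 3 * max_req nC r + 1)" using k(2) by blast
    then have "real (Suc (Suc k)) \<le> real (900 * ((nF + nC) ^ 3 * max_req nC r + 1))"
      by (rule of_nat_mono)
    then have "real (Suc (Suc k)) \<le> 900 * (real (nF + nC) ^ 3 * real (max_req nC r) + 1)" by simp
    then show ?thesis using big s'[of "length program"] unfolding solves_def by blast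
  qed
  then obtain k s' where big: "big (IfI 1 (-1) skip solve) s0 k s'"
    and k: "real k \<le> 900 * (real (nF + nC) ^ 3 * real (max_req nC r) + 1)"
    and feas: "feasible nF nC u r (out_y (length program, s')) (out_x nF nC (length program, s'))"
    and cost: "\<And>y' x'. feasible nF nC u r y' x' \<Longrightarrow>
       total_cost nF nC f c (out_y (length program, s')) (out_x nF nC (length program, s'))
         \<le> 2 * total_cost nF nC f c y' x'"
    by blast
  have "total_cost nF nC f c (out_y (length program, s')) (out_x nF nC (length program, s'))
      \<le> 289/100 * total_cost nF nC f c y' x'" if "feasible nF nC u r y' x'" for y' x'
    using cost[OF that] nonneg[OF that] by simp
  then show "\<exists>k. real k \<le> 900 * (real (nF + nC) ^ 3 * real (max_req nC r) + 1) \<and>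
           (let s = run program k (init_state nF nC f u c r) in
              halted program s \<and>
              feasible nF nC u r (out_y s) (out_x nF nC s) \<and>
              (\<forall>y' x'. feasible nF nC u r y' x' \<longrightarrow>
                 total_cost nF nC f c (out_y s) (out_x nF nC s) \<le> 289/100 * total_cost nF nC f c y' x'))"
    using k feas unfolding init Let_def
    by (intro exI[of _ k] conjI) (simp_all add: run_program[OF big] halted_end)
qed

end
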